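(* Let $\lambda>0$ be a constant external field. Consider the class of all instances $G(V,\mathcal{E},(\boldsymbol\beta,\boldsymbol\gamma))$ of the hypergraph two-state spin system with external field $\lambda$ such that, where $\Delta$ is the maximum degree of $G$, every hyperedge $e\in\mathcal{E}$ satisfies $1-\frac{2}{2e^{-1/2}\Delta+3}\le\boldsymbol\beta(e),\boldsymbol\gamma(e)\le 1$. There exists an FPTAS to compute the partition function $Z(G)$ for every instance in this class.
   Context: An instance $G(V,\mathcal{E},(\boldsymbol\beta,\boldsymbol\gamma))$ consists of a hypergraph $(V,\mathcal{E})$ (finite $V$, $\mathcal{E}\subseteq 2^V$) and two functions $\boldsymbol\beta,\boldsymbol\gamma:\mathcal{E}\to\mathbb{R}$. The degree of a vertex is the number of hyperedges containing it. A configuration is $\sigma:V\to\{0,1\}$ with weight $w(\sigma)=\prod_{e\in\mathcal{E}}w(e,\sigma)\prod_{v\in V}w(v,\sigma)$, where for $e=\{v_1,\dots,v_w\}$: $w(e,\sigma)=\boldsymbol\beta(e)$ if $\sigma(v_1)=\dots=\sigma(v_w)=0$, $w(e,\sigma)=\boldsymbol\gamma(e)$ if $\sigma(v_1)=\dots=\sigma(v_w)=1$, and $1$ otherwise; and $w(v,\sigma)=\lambda$ if $\sigma(v)=1$, $1$ otherwise. The partition function is $Z(G)=\sum_{\sigma\in\{0,1\}^V}w(\sigma)$. An FPTAS is a deterministic algorithm that, given an instance with $n$ vertices and $0<\varepsilon<1$, outputs $\hat Z$ with $e^{-\varepsilon}\le Z(G)/\hat Z\le e^{\varepsilon}$ in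 time polynomial in $n$ and $1/\varepsilon$.
   Formalization: One algorithm (unit-cost real arithmetic) serves the whole class, but the polynomial in n and 1/ε bounding its time may depend on the maximum degree Δ; a bound uniform in Δ is impossible, since the number of hyperedges to be read can be superpolynomial in n. *)

theory Defs
  imports Complex_Main "HOL-Library.FuncSet"
begin

section \<open>Two-state spin systems on hypergraphs\<close>

text \<open>The weight functions are total in HOL; only their values on hyperedges are ever used.\<close>

record 'v spin_instance =
  verts :: "'v set"
  hedges :: "'v set set"
  beta_wt :: "'v set \<Rightarrow> real"
  gamma_wt :: "'v set \<Rightarrow> real"

definition valid_instance :: "'v spin_instance \<Rightarrow> bool" where
  "valid_instance G \<longleftrightarrow> finite (verts G) \<and> hedges G \<subseteq> Pow (verts G)"

definition vdegree :: "'v spin_instance \<Rightarrow> 'v \<Rightarrow> nat" where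
  "vdegree G v = card {e \<in> hedges G. v \<in> e}"

text \<open>The element \<open>0\<close> is inserted so that the maximum is also defined for the empty vertex set.\<close>

definition max_degree :: "'v spin_instance \<Rightarrow> nat" where
  "max_degree G = Max (insert 0 (vdegree G ` verts G))"

text \<open>The cases are tried in this order, so an empty hyperedge contributes the constant
  \<open>beta_wt G {}\<close>. On nonempty hyperedges the first two cases exclude each other.\<close>

definition edge_weight :: "'v spin_instance \<Rightarrow> 'v set \<Rightarrow> ('v \<Rightarrow> nat) \<Rightarrow> real" where
  "edge_weight G e \<sigma> =
     (if \<forall>v\<in>e. \<sigma> v = 0 then beta_wt G e
      else if \<forall>v\<in>e. \<sigma> v = 1 then gamma_wt G e
      else 1)"

definition vertex_weight :: "real \<Rightarrow> 'v \<Rightarrow> ('v \<Rightarrow> nat) \<Rightarrow> real" where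
  "vertex_weight lam v \<sigma> = (if \<sigma> v = 1 then lam else 1)"

definition config_weight :: "real \<Rightarrow> 'v spin_instance \<Rightarrow> ('v \<Rightarrow> nat) \<Rightarrow> real" where
  "config_weight lam G \<sigma> =
     (\<Prod>e\<in>hedges G. edge_weight G e \<sigma>) * (\<Prod>v\<in>verts G. vertex_weight lam v \<sigma>)"

definition partition_fun :: "real \<Rightarrow> 'v spin_instance \<Rightarrow> real" where
  "partition_fun lam G = (\<Sum>\<sigma> \<in> verts G \<rightarrow>\<^sub>E {0, 1::nat}. config_weight lam G \<sigma>)"


section \<open>Deterministic algorithms with real arithmetic\<close>

text \<open>
  Since the weights are arbitrary real numbers, an algorithm is a program of a unit-cost
  real-arithmetic machine (in the style of Blum, Shub and Smale), presented as a first-order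
  recursive language over binary trees with real leaves. The primitives are the field
  operations, comparison of reals, pairing, projections and the test for the empty list.
  There is no rounding operation, the only constants are integers, and a program is a finite
  piece of syntax.
\<close>

datatype val = VReal real | VNil | VCons val val

datatype arith_op = Add | Sub | Mul | Div

text \<open>
  Variables are de Bruijn indices into the environment. \<open>Call f es\<close> runs the
  \<open>f\<close>-th function body of the program in the environment consisting of the values of
  \<open>es\<close>. \<open>IfLess a b c d\<close> branches on \<open>a < b\<close>, and \<open>IfNil a c d\<close>
  on whether \<open>a\<close> is \<open>VNil\<close>.
\<close>

datatype expr =
    Var nat
  | IntC int
  | Arith arith_op expr expr
  | NilE
  | ConsE expr expr
  | HeadE expr
  | TailE expr
  | IfLess expr expr expr expr
  | IfNil expr expr expr
  | LetE expr expr
  | Call nat "expr list"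

type_synonym program = "expr list"

fun arith :: "arith_op \<Rightarrow> real \<Rightarrow> real \<Rightarrow> real" where
  "arith Add x y = x + y"
| "arith Sub x y = x - y"
| "arith Mul x y = x * y"
| "arith Div x y = x / y"

text \<open>
  \<open>runs P env a v t\<close>: in environment \<open>env\<close> the expression \<open>a\<close> evaluates to
  \<open>v\<close> in \<open>t\<close> steps; every rule application other than those for argument lists
  costs one step. Ill-typed operations, division by zero and dangling indices have no result.
\<close>

inductive runs :: "program \<Rightarrow> val list \<Rightarrow> expr \<Rightarrow> val \<Rightarrow> nat \<Rightarrow> bool"
  and runs_list :: "program \<Rightarrow> val list \<Rightarrow> expr list \<Rightarrow> val list \<Rightarrow> nat \<Rightarrow> bool"
  for P :: program where
  Var: "i < length env \<Longrightarrow> runs P env (Var i) (env ! i) 1"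
| IntC: "runs P env (IntC k) (VReal (of_int k)) 1"
| Arith: "\<lbrakk>runs P env a (VReal x) s; runs P env b (VReal y) t; oper = Div \<Longrightarrow> y \<noteq> 0\<rbrakk>
    \<Longrightarrow> runs P env (Arith oper a b) (VReal (arith oper x y)) (s + t + 1)"
| NilE: "runs P env NilE VNil 1"
| ConsE: "\<lbrakk>runs P env a u s; runs P env b v t\<rbrakk>
    \<Longrightarrow> runs P env (ConsE a b) (VCons u v) (s + t + 1)"
| HeadE: "runs P env a (VCons u v) t \<Longrightarrow> runs P env (HeadE a) u (t + 1)"
| TailE: "runs P env a (VCons u v) t \<Longrightarrow> runs P env (TailE a) v (t + 1)"
| IfLess_True: "\<lbrakk>runs P env a (VReal x) s; runs P env b (VReal y) t; x < y; runs P env c v r\<rbrakk>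
    \<Longrightarrow> runs P env (IfLess a b c d) v (s + t + r + 1)"
| IfLess_False: "\<lbrakk>runs P env a (VReal x) s; runs P env b (VReal y) t; \<not> x < y; runs P env d v r\<rbrakk>
    \<Longrightarrow> runs P env (IfLess a b c d) v (s + t + r + 1)"
| IfNil_True: "\<lbrakk>runs P env a VNil s; runs P env c v r\<rbrakk>
    \<Longrightarrow> runs P env (IfNil a c d) v (s + r + 1)"
| IfNil_False: "\<lbrakk>runs P env a u s; u \<noteq> VNil; runs P env d v r\<rbrakk>
    \<Longrightarrow> runs P env (IfNil a c d) v (s + r + 1)"
| LetE: "\<lbrakk>runs P env a u s; runs P (u # env) b v t\<rbrakk>
    \<Longrightarrow> runs P env (LetE a b) v (s + t + 1)"
| Call: "\<lbrakk>runs_list P env as us s; f < length P; runs P us (P ! f) v t\<rbrakk>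
    \<Longrightarrow> runs P env (Call f as) v (s + t + 1)"
| Nil: "runs_list P env [] [] 0"
| Cons: "\<lbrakk>runs P env a u s; runs_list P env as us t\<rbrakk>
    \<Longrightarrow> runs_list P env (a # as) (u # us) (s + t)"

inductive_cases runs_VarE: "runs P env (Var i) v t"
inductive_cases runs_IntCE: "runs P env (IntC k) v t"
inductive_cases runs_ArithE: "runs P env (Arith oper a b) v t"
inductive_cases runs_NilEE: "runs P env NilE v t"
inductive_cases runs_ConsEE: "runs P env (ConsE a b) v t"
inductive_cases runs_HeadEE: "runs P env (HeadE a) v t"
inductive_cases runs_TailEE: "runs P env (TailE a) v t"
inductive_cases runs_IfLessE: "runs P env (IfLess a b c d) v t"
inductive_cases runs_IfNilE: "runs P env (IfNil a c d) v t"
inductive_cases runs_LetEE: "runs P env (LetE a b) v t"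
inductive_cases runs_CallE: "runs P env (Call f as) v t"
inductive_cases runs_list_NilE: "runs_list P env [] vs t"
inductive_cases runs_list_ConsE: "runs_list P env (a # as) vs t"

lemma runs_deterministic:
  "runs P env a v t \<Longrightarrow> runs P env a v' t' \<Longrightarrow> v' = v \<and> t' = t"
  "runs_list P env as vs t \<Longrightarrow> runs_list P env as vs' t' \<Longrightarrow> vs' = vs \<and> t' = t"
proof (induction arbitrary: v' t' and vs' t' rule: runs_runs_list.inducts)
  case (Var i env)
  then show ?case by (auto elim: runs_VarE)
next
  case (IntC env k)
  then show ?case by (auto elim: runs_IntCE)
next
  case (Arith env a x s b y t oper)
  show ?case using Arith.prems by (rule runs_ArithE) (auto dest!: Arith.IH(2,4))
next
  case (NilE env)
  then show ?case by (auto elim: runs_NilEE)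
next
  case (ConsE env a u s b v t)
  show ?case using ConsE.prems by (rule runs_ConsEE) (auto dest!: ConsE.IH(2,4))
next
  case (HeadE env a u v t)
  show ?case using HeadE.prems by (rule runs_HeadEE) (auto dest!: HeadE.IH(2))
next
  case (TailE env a u v t)
  show ?case using TailE.prems by (rule runs_TailEE) (auto dest!: TailE.IH(2))
next
  case (IfLess_True env a x s b y t c v r d)
  show ?case using IfLess_True.prems
    by (rule runs_IfLessE) (use IfLess_True.hyps in \<open>auto dest!: IfLess_True.IH(2,4,6)\<close>)+
next
  case (IfLess_False env a x s b y t d v r c)
  show ?case using IfLess_False.prems
    by (rule runs_IfLessE) (use IfLess_False.hyps in \<open>auto dest!: IfLess_False.IH(2,4,6)\<close>)+
next
  case (IfNil_True env a s c v r d)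
  show ?case using IfNil_True.prems
    by (rule runs_IfNilE) (auto dest!: IfNil_True.IH(2,4))+
next
  case (IfNil_False env a u s d v r c)
  show ?case using IfNil_False.prems
    by (rule runs_IfNilE) (use IfNil_False.hyps in \<open>auto dest!: IfNil_False.IH(2,4)\<close>)+
next
  case (LetE env a u s b v t)
  show ?case using LetE.prems by (rule runs_LetEE) (auto dest!: LetE.IH(2,4))
next
  case (Call env as us s f v t)
  show ?case using Call.prems by (rule runs_CallE) (auto dest!: Call.IH(2,5))
next
  case (Nil env)
  then show ?case by (auto elim: runs_list_NilE)
next
  case (Cons env a u s as us t)
  show ?case using Cons.prems by (rule runs_list_ConsE) (auto dest!: Cons.IH(2,4))
qed

text \<open>Execution starts with the first function body, run on the list of inputs.\<close>

definition computes :: "program \<Rightarrow> val list \<Rightarrow> val \<Rightarrow> nat \<Rightarrow> bool" where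
  "computes P inputs v t \<longleftrightarrow> P \<noteq> [] \<and> runs P inputs (P ! 0) v t"


section \<open>Encoding of instances\<close>

fun list_val :: "val list \<Rightarrow> val" where
  "list_val [] = VNil"
| "list_val (x # xs) = VCons x (list_val xs)"

definition vertices_val :: "nat list \<Rightarrow> val" where
  "vertices_val vs = list_val (map (\<lambda>v. VReal (real v)) vs)"

definition edge_val :: "nat spin_instance \<Rightarrow> nat list \<Rightarrow> val" where
  "edge_val G xs =
     VCons (VReal (beta_wt G (set xs))) (VCons (VReal (gamma_wt G (set xs))) (vertices_val xs))"

text \<open>An instance is presented to an algorithm by listing its vertices and its hyperedges without
  repetition, each hyperedge again as a repetition-free list of vertices. All orders are allowed.\<close>

definition listing :: "nat spin_instance \<Rightarrow> nat list \<Rightarrow> nat list list \<Rightarrow> bool" where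
  "listing G vs es \<longleftrightarrow>
     distinct vs \<and> set vs = verts G \<and>
     (\<forall>xs\<in>set es. distinct xs) \<and> distinct (map set es) \<and> set (map set es) = hedges G"

definition instance_val :: "nat spin_instance \<Rightarrow> nat list \<Rightarrow> nat list list \<Rightarrow> val" where
  "instance_val G vs es = VCons (vertices_val vs) (list_val (map (edge_val G) es))"


section \<open>Fully polynomial-time approximation schemes\<close>

text \<open>
  The external field is a constant of the problem. Programs only have integer constants, so its
  value is handed to the program as an additional input.
  As \<open>x / 0 = 0\<close>, the lower bound on the quotient rules out the output \<open>0\<close>.

  The time is measured against the number of vertices and \<open>1 / \<epsilon>\<close> alone. A program has
  to read all hyperedges, of which there may be exponentially many in general, so the notion is
  meant for classes of bounded maximum degree; the degree bound then enters the polynomial.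
\<close>

definition is_FPTAS :: "program \<Rightarrow> real \<Rightarrow> nat spin_instance set \<Rightarrow> bool" where
  "is_FPTAS P lam C \<longleftrightarrow>
     (\<exists>(c::real) (k::nat). \<forall>G\<in>C. \<forall>vs es. listing G vs es \<longrightarrow>
        (\<forall>\<epsilon>. 0 < \<epsilon> \<and> \<epsilon> < 1 \<longrightarrow>
          (\<exists>Zhat t. computes P [instance_val G vs es, VReal lam, VReal \<epsilon>] (VReal Zhat) t \<and>
             exp (- \<epsilon>) \<le> partition_fun lam G / Zhat \<and>
             partition_fun lam G / Zhat \<le> exp \<epsilon> \<and>
             real t \<le> c * (real (card (verts G)) + 1 / \<epsilon>) ^ k)))"

end

theory Submission
  imports Defs "HOL-Library.Multiset"
begin

text \<open>
  By self-reducibility it suffices to approximate the odds of spin 1 against spin 0 at a vertex \<open>v\<close>.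
  Switching the hyperedges at \<open>v\<close> one at a time from their version with \<open>v\<close> pinned to 0 to the one
  with \<open>v\<close> pinned to 1 telescopes the odds into \<open>lam\<close> times a product of factors
  \<open>(1 - (1 - g) P) / (1 - (1 - b) Q)\<close>, where \<open>P\<close> and \<open>Q\<close> are the probabilities that the rest of the
  hyperedge is constantly 1 and constantly 0 in a smaller instance. By the chain rule these are products
  of marginals, which are computed recursively, truncated by a trivial bound.

  The error is measured in the logarithm of the odds. The derivative of \<open>P = p\<^sub>1 \<cdots> p\<^sub>k\<close> is at most
  \<open>P (\<Sum>j. 1 - p\<^sub>j) \<le> p\<^sub>1 exp (- p\<^sub>1)\<close>, likewise for \<open>Q\<close> with \<open>q\<^sub>1 = 1 - p\<^sub>1\<close>, and
  \<open>x exp (- x) + (1 - x) exp (- (1 - x)) \<le> exp (- 1 / 2)\<close>. So the recursion contracts by the factor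
  \<open>2 exp (- 1 / 2) \<Delta> / (2 exp (- 1 / 2) \<Delta> + 1)\<close>. Since marginals are bounded away from 1, large
  hyperedges contract exponentially better in their size, which outweighs the smaller budget left to
  their children: the error is polynomially small in the size of the recursion tree. The algorithm doubles
  this size until the computed upper and lower bounds on the partition function agree up to
  \<open>1 + \<epsilon>\<close>; therefore it need not know the constants, and one program serves all degrees.
\<close>

section \<open>Edge lists and the truncated recursion\<close>

type_synonym edge = "real \<times> real \<times> nat list"

definition pin_edge :: "nat \<Rightarrow> bool \<Rightarrow> edge \<Rightarrow> edge" where
  "pin_edge v s = (\<lambda>(b, g, S). if v \<in> set S
     then (if s then (1, g, removeAll v S) else (b, 1, removeAll v S)) else (b, g, S))"

abbreviation pin :: "nat \<Rightarrow> bool \<Rightarrow> edge list \<Rightarrow> edge list" where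
  "pin v s \<equiv> map (pin_edge v s)"

definition deg :: "nat \<Rightarrow> edge list \<Rightarrow> nat" where
  "deg v E = length (filter (\<lambda>(b, g, S). v \<in> set S) E)"

text \<open>Unlike in \<open>edge_weight\<close>, an empty hyperedge contributes both \<open>b\<close> and \<open>g\<close>: it may arise by
  pinning all vertices of a hyperedge to either spin. \<open>empty_weight\<close> below corrects for the
  hyperedges that were empty from the start.\<close>

definition edge_wt :: "edge \<Rightarrow> nat set \<Rightarrow> real" where
  "edge_wt = (\<lambda>(b, g, S) T. (if set S \<inter> T = {} then b else 1) * (if set S \<subseteq> T then g else 1))"

definition part_sum :: "real \<Rightarrow> nat set \<Rightarrow> edge list \<Rightarrow> real" where
  "part_sum lam V E = (\<Sum>T\<in>Pow V. lam ^ card T * prod_list (map (\<lambda>e. edge_wt e T) E))"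

definition good :: "real \<Rightarrow> nat \<Rightarrow> edge list \<Rightarrow> bool" where
  "good s D E \<longleftrightarrow> (\<forall>(b, g, S)\<in>set E. 1 - s \<le> b \<and> b \<le> 1 \<and> 1 - s \<le> g \<and> g \<le> 1 \<and> distinct S)
     \<and> (\<forall>v. deg v E \<le> D)"

definition edges_in :: "nat set \<Rightarrow> edge list \<Rightarrow> bool" where
  "edges_in V E \<longleftrightarrow> (\<forall>(b, g, S)\<in>set E. set S \<subseteq> V)"

text \<open>The probability of spin 1 (if \<open>s\<close>) or spin 0 when the odds of spin 1 against spin 0 are \<open>r\<close>.\<close>

definition spin_prob :: "bool \<Rightarrow> real \<Rightarrow> real" where
  "spin_prob s r = (if s then r / (1 + r) else 1 / (1 + r))"

type_synonym approx = "edge list \<Rightarrow> nat \<Rightarrow> real \<Rightarrow> bool \<Rightarrow> real"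

text \<open>Successive pinning mirrors the chain rule: the odds of each vertex are taken given that
  the earlier ones have spin \<open>s\<close>. The list is kept apart from its product because the
  contraction argument compares the individual ratios.\<close>

primrec ratios :: "approx \<Rightarrow> bool \<Rightarrow> real \<Rightarrow> bool \<Rightarrow> edge list \<Rightarrow> nat list \<Rightarrow> real list" where
  "ratios m s B up A [] = []"
| "ratios m s B up A (u # us) = m A u B up # ratios m s B up (pin u s A) us"

definition block :: "approx \<Rightarrow> bool \<Rightarrow> real \<Rightarrow> bool \<Rightarrow> edge list \<Rightarrow> nat list \<Rightarrow> real" where
  "block m s B up A S = prod_list (map (spin_prob s) (ratios m s B up A S))"

definition factor :: "approx \<Rightarrow> real \<Rightarrow> bool \<Rightarrow> edge list \<Rightarrow> edge \<Rightarrow> nat list \<Rightarrow> real" where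
  "factor m B up A = (\<lambda>(b, g, _) S.
     (1 - (1 - g) * block m True B (\<not> up) A S) / (1 - (1 - b) * block m False B (\<not> up) A S))"

text \<open>The telescoping loop. \<open>dn\<close> holds, in reverse order, the hyperedges already
  switched to spin 1 at \<open>v\<close>; those still to come count as pinned to 0. The current
  hyperedge is left out of the instance given to \<open>factor\<close>, which measures the effect of
  adding either version of it.\<close>

fun sweep :: "approx \<Rightarrow> nat \<Rightarrow> real \<Rightarrow> bool \<Rightarrow> edge list \<Rightarrow> edge list \<Rightarrow> real \<Rightarrow> real" where
  "sweep m v B up dn [] acc = acc"
| "sweep m v B up dn ((b, g, S) # es) acc = sweep m v B up (pin_edge v True (b, g, S) # dn) es
     (if v \<in> set S
      then acc * factor m (B / length S) up (rev dn @ pin v False es) (b, g, S) (removeAll v S)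
      else acc)"

text \<open>The recursion is antitone in all its children, so an upper bound is computed from lower bounds
  and vice versa. The real number \<open>B\<close> is a budget for the size of the recursion tree; dividing it by the
  size of the hyperedge makes a hyperedge with many children recurse less deeply. The factor
  \<open>3 ^ deg v E\<close> stands in for the degree, and doubles as the trivial bound on the odds at the leaves. The
  argument \<open>n\<close> only bounds the depth: it is irrelevant once \<open>B < 4 ^ n\<close>.\<close>

primrec marg :: "real \<Rightarrow> nat \<Rightarrow> approx" where
  "marg lam 0 E v B up = (if up then lam * 3 ^ deg v E else lam / 3 ^ deg v E)"
| "marg lam (Suc n) E v B up = (if B < 1 then (if up then lam * 3 ^ deg v E else lam / 3 ^ deg v E)
     else sweep (marg lam n) v (B / (4 * 3 ^ deg v E)) up [] E lam)"

section \<open>Partition functions\<close>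

lemma ew_pin_False: "v \<notin> T \<Longrightarrow> edge_wt (pin_edge v False e) T = edge_wt e T"
  by (cases e) (auto simp: pin_edge_def edge_wt_def)

lemma ew_pin_True: "v \<notin> T \<Longrightarrow> edge_wt (pin_edge v True e) T = edge_wt e (insert v T)"
  by (cases e) (auto simp: pin_edge_def edge_wt_def)

lemma Z_insert:
  assumes "finite V" "v \<notin> V"
  shows "part_sum lam (insert v V) E = part_sum lam V (pin v False E) + lam * part_sum lam V (pin v True E)"
proof -
  have inj: "inj_on (insert v) (Pow V)" using assms(2) by (auto simp: inj_on_def)
  have "part_sum lam (insert v V) E = (\<Sum>T\<in>Pow V. lam ^ card T * prod_list (map (\<lambda>e. edge_wt e T) E))
     + (\<Sum>T\<in>insert v ` Pow V. lam ^ card T * prod_list (map (\<lambda>e. edge_wt e T) E))"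
    unfolding part_sum_def Pow_insert using assms by (intro sum.union_disjoint) auto
  also have "(\<Sum>T\<in>Pow V. lam ^ card T * prod_list (map (\<lambda>e. edge_wt e T) E)) = part_sum lam V (pin v False E)"
    unfolding part_sum_def
  proof (intro sum.cong refl)
    fix T assume "T \<in> Pow V"
    then have "v \<notin> T" using assms by auto
    then show "lam ^ card T * prod_list (map (\<lambda>e. edge_wt e T) E) =
      lam ^ card T * prod_list (map (\<lambda>e. edge_wt e T) (pin v False E))"
      by (simp add: o_def ew_pin_False)
  qed
  also have "(\<Sum>T\<in>insert v ` Pow V. lam ^ card T * prod_list (map (\<lambda>e. edge_wt e T) E))
     = lam * part_sum lam V (pin v True E)"
    unfolding part_sum_def sum.reindex[OF inj] sum_distrib_left
  proof (intro sum.cong refl)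
    fix T assume "T \<in> Pow V"
    then have "finite T" "v \<notin> T" using assms finite_subset by auto
    then show "((\<lambda>T. lam ^ card T * prod_list (map (\<lambda>e. edge_wt e T) E)) \<circ> insert v) T =
      lam * (lam ^ card T * prod_list (map (\<lambda>e. edge_wt e T) (pin v True E)))"
      by (simp add: o_def ew_pin_True)
  qed
  finally show ?thesis .
qed

text \<open>The sweep moves hyperedges to the front and reverses the processed ones; here the exact
  quantities are freed from the order.\<close>

lemma Z_mset: "mset E = mset F \<Longrightarrow> part_sum lam V E = part_sum lam V F"
  unfolding part_sum_def by (metis (no_types, lifting) mset_map prod_mset_prod_list)

lemma Z_trivial_edge: "part_sum lam V ((1, 1, S) # E) = part_sum lam V E"
  by (simp add: part_sum_def edge_wt_def)

lemma Z_empty_edge: "part_sum lam V ((b, g, []) # E) = b * g * part_sum lam V E"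
  by (simp add: part_sum_def edge_wt_def sum_distrib_left mult_ac)

lemma Z_pos:
  assumes "lam > 0" "finite V" "\<And>b g S. (b, g, S) \<in> set E \<Longrightarrow> b > 0 \<and> g > 0"
  shows "part_sum lam V E > 0"
proof -
  have "prod_list (map (\<lambda>e. edge_wt e T) E) > 0" for T
    using assms(3)
  proof (induction E)
    case (Cons e E)
    obtain b g S where e: "e = (b, g, S)" by (cases e)
    have "0 < b" "0 < g" using Cons.prems[of b g S] by (auto simp: e)
    then have "edge_wt e T > 0" by (simp add: edge_wt_def e)
    moreover have "prod_list (map (\<lambda>e. edge_wt e T) E) > 0" using Cons by auto
    ultimately show ?case by simp
  qed simp
  then show ?thesis unfolding part_sum_def using assms by (intro sum_pos) auto
qed

section \<open>Odds of a vertex and the chain rule\<close>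

definition odds :: "real \<Rightarrow> nat set \<Rightarrow> edge list \<Rightarrow> nat \<Rightarrow> real" where
  "odds lam V E v = lam * part_sum lam (V - {v}) (pin v True E) / part_sum lam (V - {v}) (pin v False E)"

definition posw :: "edge list \<Rightarrow> bool" where
  "posw E \<longleftrightarrow> (\<forall>(b, g, S)\<in>set E. 0 < b \<and> 0 < g)"

lemma posw_Z: "posw E \<Longrightarrow> lam > 0 \<Longrightarrow> finite V \<Longrightarrow> part_sum lam V E > 0"
  by (rule Z_pos) (auto simp: posw_def)

lemma posw_pin [simp]: "posw E \<Longrightarrow> posw (pin v s E)"
  by (fastforce simp: posw_def pin_edge_def split: if_splits)

text \<open>The exact counterpart of \<open>block\<close>: the probability that all listed vertices
  have spin \<open>s\<close>.\<close>

primrec chain :: "real \<Rightarrow> bool \<Rightarrow> nat set \<Rightarrow> edge list \<Rightarrow> nat list \<Rightarrow> real" where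
  "chain lam s V A [] = 1"
| "chain lam s V A (u # us) = spin_prob s (odds lam V A u) * chain lam s (V - {u}) (pin u s A) us"

lemma Z_split:
  assumes "finite V" "v \<in> V"
  shows "part_sum lam V E = part_sum lam (V - {v}) (pin v False E) + lam * part_sum lam (V - {v}) (pin v True E)"
  using Z_insert[of "V - {v}" v lam E] assms by (simp add: insert_absorb)

lemma odds_pos: "posw E \<Longrightarrow> lam > 0 \<Longrightarrow> finite V \<Longrightarrow> odds lam V E v > 0"
  unfolding odds_def by (intro divide_pos_pos mult_pos_pos posw_Z) auto

lemma spin_prob_odds:
  assumes "lam > 0" "finite V" "u \<in> V" "posw A"
  shows "spin_prob True (odds lam V A u) * part_sum lam V A = lam * part_sum lam (V - {u}) (pin u True A)"
    and "spin_prob False (odds lam V A u) * part_sum lam V A = part_sum lam (V - {u}) (pin u False A)"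
proof -
  have *: "part_sum lam (V - {u}) (pin u s A) > 0" for s
    using assms by (intro posw_Z) auto
  show "spin_prob True (odds lam V A u) * part_sum lam V A = lam * part_sum lam (V - {u}) (pin u True A)"
    and "spin_prob False (odds lam V A u) * part_sum lam V A = part_sum lam (V - {u}) (pin u False A)"
    unfolding Z_split[OF assms(2,3)] spin_prob_def odds_def
    using *[of True] *[of False] assms(1)
    by (simp_all add: field_simps add_pos_pos less_imp_neq[symmetric])
qed

text \<open>Adding the hyperedge multiplies the partition function by the expectation of its weight,
  which differs from 1 only when all of \<open>S\<close> has spin 1. In the induction, spin 0 at the
  first vertex makes the hyperedge trivial, and spin 1 leaves a hyperedge of the same kind on the
  tail.\<close>

lemma Z_chain_True:
  assumes "lam > 0" "finite V" "set S \<subseteq> V" "distinct S" "posw A"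
  shows "part_sum lam V ((1, g, S) # A) = part_sum lam V A * (1 - (1 - g) * chain lam True V A S)"
  using assms
proof (induction S arbitrary: V A)
  case Nil
  then show ?case by (simp add: Z_empty_edge)
next
  case (Cons u us)
  have [simp]: "removeAll u us = us" using Cons.prems by (simp add: removeAll_id)
  have IH: "part_sum lam (V - {u}) ((1, g, us) # pin u True A) =
    part_sum lam (V - {u}) (pin u True A) * (1 - (1 - g) * chain lam True (V - {u}) (pin u True A) us)"
    using Cons.prems by (intro Cons.IH) auto
  have "part_sum lam V ((1, g, u # us) # A) = part_sum lam (V - {u}) (pin u False A)
     + lam * part_sum lam (V - {u}) ((1, g, us) # pin u True A)"
    using Cons.prems by (subst Z_split[of _ u]) (auto simp: pin_edge_def Z_trivial_edge)
  also have "\<dots> = part_sum lam V A - (1 - g) * chain lam True (V - {u}) (pin u True A) us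
      * (lam * part_sum lam (V - {u}) (pin u True A))"
    unfolding IH using Cons.prems by (subst (3) Z_split[of _ u]) (auto simp: algebra_simps)
  also have "lam * part_sum lam (V - {u}) (pin u True A) = spin_prob True (odds lam V A u) * part_sum lam V A"
    using Cons.prems by (subst spin_prob_odds) auto
  finally show ?case by (simp add: algebra_simps)
qed

lemma Z_chain_False:
  assumes "lam > 0" "finite V" "set S \<subseteq> V" "distinct S" "posw A"
  shows "part_sum lam V ((b, 1, S) # A) = part_sum lam V A * (1 - (1 - b) * chain lam False V A S)"
  using assms
proof (induction S arbitrary: V A)
  case Nil
  then show ?case by (simp add: Z_empty_edge)
next
  case (Cons u us)
  have [simp]: "removeAll u us = us" using Cons.prems by (simp add: removeAll_id)
  have IH: "part_sum lam (V - {u}) ((b, 1, us) # pin u False A) =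
    part_sum lam (V - {u}) (pin u False A) * (1 - (1 - b) * chain lam False (V - {u}) (pin u False A) us)"
    using Cons.prems by (intro Cons.IH) auto
  have "part_sum lam V ((b, 1, u # us) # A) = part_sum lam (V - {u}) ((b, 1, us) # pin u False A)
     + lam * part_sum lam (V - {u}) (pin u True A)"
    using Cons.prems by (subst Z_split[of _ u]) (auto simp: pin_edge_def Z_trivial_edge)
  also have "\<dots> = part_sum lam V A - (1 - b) * chain lam False (V - {u}) (pin u False A) us
      * part_sum lam (V - {u}) (pin u False A)"
    unfolding IH using Cons.prems by (subst (3) Z_split[of _ u]) (auto simp: algebra_simps)
  also have "part_sum lam (V - {u}) (pin u False A) = spin_prob False (odds lam V A u) * part_sum lam V A"
    using Cons.prems by (subst spin_prob_odds) auto
  finally show ?case by (simp add: algebra_simps)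
qed

section \<open>Contraction\<close>

text \<open>The right-hand side is the tangent of \<open>x * exp (- x)\<close> at 1/2. Adding the
  tangents at \<open>x\<close> and \<open>1 - x\<close> cancels the linear terms, which leaves
  \<open>exp (- 1 / 2)\<close>.\<close>

lemma x_exp_tangent: "0 \<le> x \<Longrightarrow> x * exp (- x) \<le> exp (- 1 / 2) * ((x + 1 / 2) / 2)" for x :: real
proof -
  assume "0 \<le> x"
  define u where "u = x - 1 / 2"
  have "1 + 2 * u \<le> (1 + u) * (1 + u)" by (simp add: algebra_simps)
  also have "\<dots> \<le> (1 + u) * exp u"
    using \<open>0 \<le> x\<close> exp_ge_add_one_self[of u] by (intro mult_left_mono) (auto simp: u_def)
  finally have "(1 + 2 * u) * exp (- u) \<le> 1 + u"
    by (simp add: exp_minus divide_simps mult.commute)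
  then have "exp (- 1 / 2) * ((1 + 2 * u) * exp (- u)) \<le> exp (- 1 / 2) * (1 + u)"
    by (intro mult_left_mono) auto
  moreover have "exp (- x) = exp (- 1 / 2) * exp (- u)"
    by (simp add: u_def flip: exp_add)
  ultimately show ?thesis by (simp add: u_def field_simps)
qed

lemma x_exp_pair:
  fixes x :: real
  assumes "0 \<le> x" "x \<le> 1"
  shows "x * exp (- x) + (1 - x) * exp (- (1 - x)) \<le> exp (- 1 / 2)"
  using x_exp_tangent[of x] x_exp_tangent[of "1 - x"] assms by (simp add: field_simps)

lemma prod_list_le_exp:
  fixes ps :: "real list"
  assumes "\<And>p. p \<in> set ps \<Longrightarrow> 0 \<le> p"
  shows "prod_list ps \<le> exp (- sum_list (map (\<lambda>p. 1 - p) ps))"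
  using assms
proof (induction ps)
  case (Cons p ps)
  have "p \<le> exp (- (1 - p))" using exp_ge_add_one_self[of "p - 1"] by simp
  then have "p * prod_list ps \<le> exp (- (1 - p)) * exp (- sum_list (map (\<lambda>p. 1 - p) ps))"
    using Cons by (intro mult_mono prod_list_nonneg) auto
  then show ?case by (simp flip: exp_add add: algebra_simps)
qed simp

text \<open>Only the first factor survives: if \<tau> is the sum of \<open>1 - p\<close> over the
  tail, the product of the tail is at most \<open>exp (- \<tau>)\<close> and the full sum
  \<open>1 - x + \<tau>\<close> is at most \<open>exp (- x + \<tau>)\<close>, so \<tau>
  cancels.\<close>

lemma prod_sum_le:
  fixes x :: real
  assumes "0 \<le> x" "x \<le> 1" "\<And>p. p \<in> set ps \<Longrightarrow> 0 \<le> p \<and> p \<le> 1"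
  shows "prod_list (x # ps) * sum_list (map (\<lambda>p. 1 - p) (x # ps)) \<le> x * exp (- x)"
proof -
  define \<tau> where "\<tau> = sum_list (map (\<lambda>p. 1 - p) ps)"
  have \<tau>: "\<tau> \<ge> 0" unfolding \<tau>_def using assms by (intro sum_list_nonneg) auto
  have "prod_list ps * (1 - x + \<tau>) \<le> exp (- \<tau>) * exp (- x + \<tau>)"
  proof (rule mult_mono)
    show "prod_list ps \<le> exp (- \<tau>)"
      unfolding \<tau>_def using assms by (intro prod_list_le_exp) auto
    show "1 - x + \<tau> \<le> exp (- x + \<tau>)"
      using exp_ge_add_one_self[of "- x + \<tau>"] by linarith
  qed (use \<tau> assms in auto)
  also have "\<dots> = exp (- x)" by (simp flip: exp_add)
  finally have "x * (prod_list ps * (1 - x + \<tau>)) \<le> x * exp (- x)"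
    using assms by (intro mult_left_mono) auto
  then show ?thesis by (simp add: \<tau>_def mult.assoc)
qed

lemma prod_list_le_power:
  fixes ps :: "real list"
  assumes "\<And>p. p \<in> set ps \<Longrightarrow> 0 \<le> p \<and> p \<le> h" "0 \<le> h"
  shows "prod_list ps \<le> h ^ length ps"
  using assms
proof (induction ps)
  case (Cons p ps)
  then have "p * prod_list ps \<le> h * h ^ length ps"
    by (intro mult_mono prod_list_nonneg) auto
  then show ?case by simp
qed simp

lemma prod_sum_le_power:
  fixes ps :: "real list" and h :: real
  assumes "\<And>p. p \<in> set ps \<Longrightarrow> 0 \<le> p \<and> p \<le> h" "0 \<le> h" "h \<le> 1"
  shows "prod_list ps * sum_list (map (\<lambda>p. 1 - p) ps) \<le> length ps * h ^ length ps"
proof -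
  have "sum_list (map (\<lambda>p. 1 - p) ps) \<le> sum_list (map (\<lambda>p. 1) ps)"
    using assms by (intro sum_list_mono) auto
  then have "sum_list (map (\<lambda>p. 1 - p) ps) \<le> length ps"
    by (simp add: sum_list_triv)
  moreover have "0 \<le> sum_list (map (\<lambda>p. 1 - p) ps)"
    using assms by (intro sum_list_nonneg) (auto, meson order_trans)
  ultimately have "prod_list ps * sum_list (map (\<lambda>p. 1 - p) ps) \<le> h ^ length ps * length ps"
    using assms by (intro mult_mono prod_list_le_power) auto
  then show ?thesis by (simp add: mult.commute)
qed

text \<open>The first bound gives the contraction under the hypothesis on the weights, the second one
  makes up for the large number of children of a large hyperedge.\<close>

definition kappa :: "real \<Rightarrow> nat \<Rightarrow> real" where
  "kappa h k = min (exp (- 1 / 2)) (2 * (k * h ^ k))"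

lemma kappa_nonneg: "0 \<le> h \<Longrightarrow> 0 \<le> kappa h k"
  by (simp add: kappa_def)

lemma prod_sum_pair_le:
  fixes ps qs :: "real list"
  assumes ps: "\<And>p. p \<in> set ps \<Longrightarrow> 0 \<le> p \<and> p \<le> h" and qs: "\<And>p. p \<in> set qs \<Longrightarrow> 0 \<le> p \<and> p \<le> h"
    and h: "0 \<le> h" "h \<le> 1" and len: "length ps = k" "length qs = k"
    and hd: "k > 0 \<Longrightarrow> hd ps + hd qs = 1"
  shows "prod_list ps * sum_list (map (\<lambda>p. 1 - p) ps) + prod_list qs * sum_list (map (\<lambda>p. 1 - p) qs)
    \<le> kappa h k"
proof -
  have "prod_list ps * sum_list (map (\<lambda>p. 1 - p) ps) + prod_list qs * sum_list (map (\<lambda>p. 1 - p) qs)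
      \<le> exp (- 1 / 2)"
  proof (cases ps)
    case Nil
    then show ?thesis using len by simp
  next
    case (Cons x ps')
    then obtain qs' where q: "qs = (1 - x) # qs'" using len hd by (cases qs) auto
    have x: "0 \<le> x" "x \<le> 1" using ps[of x] h Cons by auto
    have ps': "0 \<le> p \<and> p \<le> 1" if "p \<in> set ps'" for p using ps[of p] that h Cons by auto
    have qs': "0 \<le> p \<and> p \<le> 1" if "p \<in> set qs'" for p using qs[of p] that h q by auto
    show ?thesis
      using prod_sum_le[of x ps', OF x ps'] prod_sum_le[of "1 - x" qs', OF _ _ qs'] x x_exp_pair[OF x]
      unfolding Cons q by linarith
  qed
  moreover have "prod_list ps * sum_list (map (\<lambda>p. 1 - p) ps) + prod_list qs * sum_list (map (\<lambda>p. 1 - p) qs)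
      \<le> 2 * (k * h ^ k)"
    using prod_sum_le_power[of ps h, OF ps h] prod_sum_le_power[of qs h, OF qs h] len by simp
  ultimately show ?thesis by (simp add: kappa_def)
qed

section \<open>Derivatives along a path of log-odds\<close>

lemma DERIV_prod_list:
  assumes "\<And>z. z \<in> set zs \<Longrightarrow> (p z has_real_derivative p z t * (1 - p z t) * D z) (at t)"
  shows "((\<lambda>t. prod_list (map (\<lambda>z. p z t) zs)) has_real_derivative
    prod_list (map (\<lambda>z. p z t) zs) * sum_list (map (\<lambda>z. (1 - p z t) * D z) zs)) (at t)"
  using assms
proof (induction zs)
  case (Cons z zs)
  have "((\<lambda>t. p z t * prod_list (map (\<lambda>z. p z t) zs)) has_real_derivative
    p z t * (1 - p z t) * D z * prod_list (map (\<lambda>z. p z t) zs) +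
    (prod_list (map (\<lambda>z. p z t) zs) * sum_list (map (\<lambda>z. (1 - p z t) * D z) zs)) * p z t) (at t)"
    using Cons by (intro DERIV_mult) auto
  then show ?case by (simp add: algebra_simps)
qed simp

text \<open>The path is linear in the log-odds. In this coordinate the probability of a spin is a
  logistic function, hence the derivative \<open>p * (1 - p)\<close> times a constant and the sums
  of \<open>1 - p\<close> in the bounds above.\<close>

definition log_interp :: "real \<times> real \<Rightarrow> real \<Rightarrow> real" where
  "log_interp = (\<lambda>(l, h) t. exp ((1 - t) * ln l + t * ln h))"

lemma DERIV_log_interp_True:
  "((\<lambda>t. spin_prob True (log_interp z t)) has_real_derivative
     spin_prob True (log_interp z t) * (1 - spin_prob True (log_interp z t)) * (ln (snd z) - ln (fst z))) (at t)"
proof -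
  have p: "log_interp z t > 0" by (simp add: log_interp_def split: prod.split)
  have "((\<lambda>t. log_interp z t) has_real_derivative log_interp z t * (ln (snd z) - ln (fst z))) (at t)"
    unfolding log_interp_def case_prod_beta by (auto intro!: derivative_eq_intros simp: algebra_simps)
  then show ?thesis
    unfolding spin_prob_def using p
    by (auto intro!: derivative_eq_intros simp: field_simps power2_eq_square)
qed

lemma DERIV_log_interp_False:
  "((\<lambda>t. spin_prob False (log_interp z t)) has_real_derivative
     spin_prob False (log_interp z t) * (1 - spin_prob False (log_interp z t)) * (- (ln (snd z) - ln (fst z)))) (at t)"
proof -
  have p: "log_interp z t > 0" by (simp add: log_interp_def split: prod.split)
  have "((\<lambda>t. log_interp z t) has_real_derivative log_interp z t * (ln (snd z) - ln (fst z))) (at t)"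
    unfolding log_interp_def case_prod_beta by (auto intro!: derivative_eq_intros simp: algebra_simps)
  then show ?thesis
    unfolding spin_prob_def using p
    by (auto intro!: derivative_eq_intros simp: field_simps power2_eq_square)
qed

lemma sum_list_mono_mult:
  fixes d :: real
  assumes "\<And>z. z \<in> set zs \<Longrightarrow> 0 \<le> f z \<and> D z \<le> d"
  shows "sum_list (map (\<lambda>z. f z * D z) zs) \<le> d * sum_list (map f zs)"
  unfolding sum_list_const_mult[symmetric] using assms
  by (intro sum_list_mono) (subst mult.commute, auto intro!: mult_left_mono mult_right_mono)

text \<open>The pairs are lower and upper bounds on the odds of the children, with logarithms at most
  \<open>\<delta>\<close> apart. Both products of an edge start with the same child; the constant
  \<open>exp (- 1 / 2)\<close> is available only because of this.\<close>

lemma contraction: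
  assumes zs: "\<And>l h. (l, h) \<in> set zs \<union> set ws \<Longrightarrow>
      a \<le> l \<and> l \<le> h \<and> h \<le> b \<and> ln h - ln l \<le> \<delta>"
    and a: "0 < a" and len: "length zs = k" "length ws = k" and hd: "k > 0 \<Longrightarrow> hd zs = hd ws"
    and eta: "b / (1 + b) \<le> \<eta>" "1 / (1 + a) \<le> \<eta>" "\<eta> \<le> 1" and "0 \<le> \<delta>"
  shows "(prod_list (map (spin_prob True \<circ> snd) zs) - prod_list (map (spin_prob True \<circ> fst) zs)) +
    (prod_list (map (spin_prob False \<circ> fst) ws) - prod_list (map (spin_prob False \<circ> snd) ws))
     \<le> kappa \<eta> k * \<delta>"
proof -
  define P where "P t = prod_list (map (\<lambda>z. spin_prob True (log_interp z t)) zs)" for t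
  define Q where "Q t = prod_list (map (\<lambda>z. spin_prob False (log_interp z t)) ws)" for t
  define P' where "P' t = P t * sum_list (map (\<lambda>z. (1 - spin_prob True (log_interp z t)) * (ln (snd z) - ln (fst z))) zs)" for t
  define Q' where "Q' t = Q t * sum_list (map (\<lambda>z. (1 - spin_prob False (log_interp z t)) * (- (ln (snd z) - ln (fst z)))) ws)" for t
  have "((\<lambda>t. P t - Q t) has_real_derivative P' t - Q' t) (at t)" for t
    unfolding P_def Q_def P'_def Q'_def
    by (intro DERIV_diff DERIV_prod_list DERIV_log_interp_True DERIV_log_interp_False)
  \<comment> \<open>The mean value theorem is applied to \<open>P - Q\<close> rather than to each
    product, so both derivatives are taken at the same \<open>t\<close>. Hence the common first
    child has one value there, and its two spin probabilities add up to 1.\<close>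
  then obtain t where t: "0 < t" "t < 1" and mvt: "(P 1 - Q 1) - (P 0 - Q 0) = P' t - Q' t"
    using MVT2[of 0 1 "\<lambda>t. P t - Q t" "\<lambda>t. P' t - Q' t"] by auto
  have itp: "a \<le> log_interp z t \<and> log_interp z t \<le> b" if z: "z \<in> set zs \<union> set ws" for z
  proof -
    obtain l h where zlh: "z = (l, h)" by (cases z)
    have lh: "a \<le> l" "l \<le> h" "h \<le> b" using zs[of l h] z zlh by auto
    have "ln a \<le> ln l" "ln l \<le> ln h" "ln h \<le> ln b" using lh a by auto
    then have "(1 - t) * ln a + t * ln a \<le> (1 - t) * ln l + t * ln h"
        "(1 - t) * ln l + t * ln h \<le> (1 - t) * ln b + t * ln b"
      using t by (auto intro!: add_mono mult_left_mono)
    then have "ln a \<le> (1 - t) * ln l + t * ln h" "(1 - t) * ln l + t * ln h \<le> ln b"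
      by (simp_all add: algebra_simps)
    then have "exp (ln a) \<le> log_interp z t" "log_interp z t \<le> exp (ln b)" by (simp_all add: log_interp_def zlh)
    then show ?thesis using a lh by simp
  qed
  have d: "0 \<le> spin_prob s (log_interp z t) \<and> spin_prob s (log_interp z t) \<le> \<eta>" if z: "z \<in> set zs \<union> set ws" for z s
  proof -
    have 1: "a \<le> log_interp z t" "log_interp z t \<le> b" using itp[OF z] by auto
    have "log_interp z t / (1 + log_interp z t) \<le> b / (1 + b)" using 1 a by (simp add: field_simps)
    moreover have "1 / (1 + log_interp z t) \<le> 1 / (1 + a)" using 1 a by (simp add: field_simps)
    ultimately show ?thesis using 1 a eta by (auto simp: spin_prob_def intro: order_trans)
  qed
  have d1: "spin_prob s (log_interp z t) \<le> 1" if "z \<in> set zs \<union> set ws" for z s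
    using d[OF that, of s] eta by linarith
  have \<eta>0: "0 \<le> \<eta>" using eta(2) a by (smt (verit) divide_nonneg_pos)
  have "P' t \<le> P t * (\<delta> * sum_list (map (\<lambda>z. 1 - spin_prob True (log_interp z t)) zs))"
    unfolding P'_def using zs d1 d
    by (intro mult_left_mono sum_list_mono_mult) (auto simp: P_def intro!: prod_list_nonneg)
  moreover have "- Q' t = Q t * sum_list (map (\<lambda>z. (1 - spin_prob False (log_interp z t)) * (ln (snd z) - ln (fst z))) ws)"
  proof -
    have neg: "sum_list (map (\<lambda>z. f z * - g z) xs) = - sum_list (map (\<lambda>z. f z * g z) xs)"
      for f g :: "real \<times> real \<Rightarrow> real" and xs
      by (induction xs) auto
    show ?thesis unfolding Q'_def neg by simp
  qed
  moreover have "\<dots> \<le> Q t * (\<delta> * sum_list (map (\<lambda>z. 1 - spin_prob False (log_interp z t)) ws))"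
    using zs d1 d by (intro mult_left_mono sum_list_mono_mult) (auto simp: Q_def intro!: prod_list_nonneg)
  ultimately have "P' t - Q' t \<le> (P t * sum_list (map (\<lambda>z. 1 - spin_prob True (log_interp z t)) zs)
      + Q t * sum_list (map (\<lambda>z. 1 - spin_prob False (log_interp z t)) ws)) * \<delta>"
    by (simp add: algebra_simps)
  also have "P t * sum_list (map (\<lambda>z. 1 - spin_prob True (log_interp z t)) zs)
      + Q t * sum_list (map (\<lambda>z. 1 - spin_prob False (log_interp z t)) ws) \<le> kappa \<eta> k"
  proof -
    have hd1: "hd (map (\<lambda>z. spin_prob True (log_interp z t)) zs) + hd (map (\<lambda>z. spin_prob False (log_interp z t)) ws) = 1"
      if "k > 0"
    proof -
      have "log_interp (hd ws) t > 0" by (simp add: log_interp_def split: prod.split)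
      moreover have "zs \<noteq> []" "ws \<noteq> []" using that len by auto
      ultimately show ?thesis using hd[OF that] by (simp add: hd_map spin_prob_def field_simps)
    qed
    show ?thesis
      using prod_sum_pair_le[of "map (\<lambda>z. spin_prob True (log_interp z t)) zs" \<eta>
        "map (\<lambda>z. spin_prob False (log_interp z t)) ws" k, OF _ _ \<eta>0 eta(3) _ _ hd1] d len
      unfolding P_def Q_def map_map o_def by fastforce
  qed
  finally have le: "P' t - Q' t \<le> kappa \<eta> k * \<delta>" using \<open>0 \<le> \<delta>\<close> by (simp add: mult_right_mono)
  have "log_interp z 0 = fst z \<and> log_interp z 1 = snd z" if z: "z \<in> set zs \<union> set ws" for z
    using zs[of "fst z" "snd z"] that a by (auto simp: log_interp_def case_prod_beta)
  then have "P 1 = prod_list (map (spin_prob True \<circ> snd) zs)" "P 0 = prod_list (map (spin_prob True \<circ> fst) zs)"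
     "Q 0 = prod_list (map (spin_prob False \<circ> fst) ws)" "Q 1 = prod_list (map (spin_prob False \<circ> snd) ws)"
    unfolding P_def Q_def by (auto intro!: arg_cong[where f = prod_list])
  then show ?thesis using le mvt by simp
qed

section \<open>Contraction against the division of the budget\<close>

lemma linear_times_power_tendsto_0:
  fixes x :: real
  assumes "0 \<le> x" "x < 1"
  shows "(\<lambda>k. (real k + 1) * x ^ k) \<longlonglongrightarrow> 0"
proof -
  have "(\<lambda>k. real k * x ^ k + x ^ k) \<longlonglongrightarrow> 0 + 0"
    using assms by (intro tendsto_add powser_times_n_limit_0 LIMSEQ_power_zero) auto
  then show ?thesis by (simp add: algebra_simps)
qed

text \<open>For large \<open>k\<close> the bound \<open>2 * (k * \<eta> ^ k)\<close> beats the power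
  for every \<open>c \<le> 1\<close>. For the finitely many other \<open>k\<close> the strict gap
  between \<open>\<tau> * exp (- 1 / 2)\<close> and \<theta> leaves room for the power, by
  continuity at \<open>c = 0\<close>.\<close>

lemma decay_exponent_exists:
  assumes eta: "0 \<le> \<eta>" "\<eta> < 1" and tau: "0 \<le> \<tau>" "\<tau> * exp (- 1 / 2) < \<theta>" and M: "1 \<le> M"
  shows "\<exists>c>0. \<forall>k::nat. \<tau> * kappa \<eta> k * (M * (real k + 1)) powr c \<le> \<theta>"
proof -
  \<comment> \<open>Two linear factors have to be beaten, one from \<open>kappa\<close> and one from
    the power at \<open>c = 1\<close>. Splitting \<open>\<eta> ^ k\<close> into
    \<open>x ^ k * x ^ k\<close> gives one geometric factor to each.\<close>
  define x where "x = sqrt \<eta>"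
  have x: "0 \<le> x" "x < 1" "x ^ 2 = \<eta>" using eta by (auto simp: x_def)
  have "(\<lambda>k. \<tau> * 2 * M * (((real k + 1) * x ^ k) * ((real k + 1) * x ^ k))) \<longlonglongrightarrow> \<tau> * 2 * M * (0 * 0)"
    by (intro tendsto_intros linear_times_power_tendsto_0 x)
  moreover have "0 < \<theta>" using tau by (smt (verit) exp_gt_zero mult_nonneg_nonneg)
  ultimately have "eventually (\<lambda>k. \<tau> * 2 * M * (((real k + 1) * x ^ k) * ((real k + 1) * x ^ k)) < \<theta>) sequentially"
    by (intro order_tendstoD) auto
  then obtain K where K: "\<And>k. k \<ge> K \<Longrightarrow> \<tau> * 2 * M * (((real k + 1) * x ^ k) * ((real k + 1) * x ^ k)) < \<theta>"
    by (auto simp: eventually_sequentially)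
  define X where "X = M * (real K + 1)"
  have X: "1 \<le> X" unfolding X_def using M by (metis mult_mono' mult_1 le_add_same_cancel2 of_nat_0_le_iff zero_le_one)
  have "((\<lambda>c. \<tau> * exp (- 1 / 2) * X powr c) \<longlongrightarrow> \<tau> * exp (- 1 / 2) * X powr 0) (at_right 0)"
    using X by (intro tendsto_intros) auto
  then have "eventually (\<lambda>c. \<tau> * exp (- 1 / 2) * X powr c < \<theta>) (at_right 0)"
    using tau X by (intro order_tendstoD) auto
  moreover have "eventually (\<lambda>c::real. c \<in> {0<..<1}) (at_right 0)"
    by (rule eventually_at_right_real) auto
  ultimately have "eventually (\<lambda>c. \<tau> * exp (- 1 / 2) * X powr c < \<theta> \<and> c \<in> {0<..<1}) (at_right 0)"
    by (rule eventually_conj)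
  then obtain c where c: "\<tau> * exp (- 1 / 2) * X powr c < \<theta>" "0 < c" "c < 1"
    by (auto dest!: eventually_happens)
  have "\<tau> * kappa \<eta> k * (M * (real k + 1)) powr c \<le> \<theta>" for k
  proof (cases "k \<ge> K")
    case True
    have 1: "1 \<le> M * (real k + 1)" using M by (metis mult_mono' mult_1 le_add_same_cancel2 of_nat_0_le_iff zero_le_one)
    have "(M * (real k + 1)) powr c \<le> (M * (real k + 1)) powr 1"
      using c 1 by (intro powr_mono) auto
    moreover have "\<tau> * kappa \<eta> k \<le> \<tau> * (2 * (real k * \<eta> ^ k))"
      using tau by (intro mult_left_mono) (auto simp: kappa_def)
    moreover have "real k * \<eta> ^ k \<le> (real k + 1) * \<eta> ^ k" using eta by (intro mult_right_mono) auto
    then have "\<tau> * (2 * (real k * \<eta> ^ k)) \<le> \<tau> * (2 * ((real k + 1) * \<eta> ^ k))"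
      using tau by (intro mult_left_mono) auto
    ultimately have "\<tau> * kappa \<eta> k * (M * (real k + 1)) powr c
        \<le> \<tau> * (2 * ((real k + 1) * \<eta> ^ k)) * (M * (real k + 1))"
      using tau eta M by (intro mult_mono order_trans[OF \<open>\<tau> * kappa \<eta> k \<le> _\<close>]) auto
    also have "\<dots> = \<tau> * 2 * M * (((real k + 1) * x ^ k) * ((real k + 1) * x ^ k))"
    proof -
      have "\<eta> ^ k = x ^ k * x ^ k"
        by (simp add: x(3)[symmetric] power2_eq_square power_mult_distrib)
      then show ?thesis by simp
    qed
    also have "\<dots> \<le> \<theta>" using K[OF True] by simp
    finally show ?thesis .
  next
    case False
    have "(M * (real k + 1)) powr c \<le> X powr c"
      using False M c unfolding X_def by (intro powr_mono2 mult_left_mono) auto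
    moreover have "\<tau> * kappa \<eta> k \<le> \<tau> * exp (- 1 / 2)"
      using tau by (intro mult_left_mono) (auto simp: kappa_def)
    ultimately have "\<tau> * kappa \<eta> k * (M * (real k + 1)) powr c \<le> \<tau> * exp (- 1 / 2) * X powr c"
      using tau kappa_nonneg[OF eta(1), of k] by (intro mult_mono) (auto simp: kappa_def)
    then show ?thesis using c by linarith
  qed
  then show ?thesis using c by blast
qed

section \<open>Invariants of pinned instances\<close>

lemma deg_simps [simp]:
  "deg v [] = 0"
  "deg v (e # E) = (if v \<in> set (snd (snd e)) then 1 else 0) + deg v E"
  "deg v (E @ F) = deg v E + deg v F"
  "deg v (rev E) = deg v E"
  by (auto simp: deg_def case_prod_beta simp flip: rev_filter)

lemma set_pin_edge [simp]:
  "set (snd (snd (pin_edge v s e))) = set (snd (snd e)) - {v}"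
  by (auto simp: pin_edge_def split: prod.split)

lemma deg_pin_le: "deg u (pin v s E) \<le> deg u E"
  by (induction E) auto

definition edge_ok :: "real \<Rightarrow> edge \<Rightarrow> bool" where
  "edge_ok s = (\<lambda>(b, g, S). 1 - s \<le> b \<and> b \<le> 1 \<and> 1 - s \<le> g \<and> g \<le> 1 \<and> distinct S)"

lemma good_alt: "good s D E \<longleftrightarrow> (\<forall>e\<in>set E. edge_ok s e) \<and> (\<forall>v. deg v E \<le> D)"
  by (simp add: good_def edge_ok_def)

lemma edge_ok_pin: "0 \<le> s \<Longrightarrow> edge_ok s e \<Longrightarrow> edge_ok s (pin_edge v t e)"
  by (auto simp: edge_ok_def pin_edge_def distinct_removeAll split: prod.splits)

lemma good_pin: "good s D E \<Longrightarrow> 0 \<le> s \<Longrightarrow> good s D (pin v t E)"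
  unfolding good_alt
proof (intro conjI ballI allI)
  fix u assume "(\<forall>e\<in>set E. edge_ok s e) \<and> (\<forall>v. deg v E \<le> D)"
  then show "deg u (pin v t E) \<le> D" using deg_pin_le order_trans by blast
qed (use edge_ok_pin in auto)

lemma good_step:
  assumes "good s D (rev dn @ e # es)" "0 \<le> s"
  shows "good s D (rev dn @ pin v False es)" "good s D (rev (pin_edge v t e # dn) @ es)"
proof -
  have "deg u dn + deg u (pin v False es) \<le> D \<and>
     deg u dn + ((if u \<in> set (snd (snd e)) - {v} then 1 else 0) + deg u es) \<le> D" for u
  proof -
    have "deg u (pin v False es) \<le> deg u es" by (rule deg_pin_le)
    moreover have "deg u (rev dn @ e # es) \<le> D" using assms unfolding good_alt by blast
    ultimately show ?thesis by (auto split: if_splits)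
  qed
  then show "good s D (rev dn @ pin v False es)" "good s D (rev (pin_edge v t e # dn) @ es)"
    using assms edge_ok_pin[OF assms(2)] unfolding good_alt by (auto split: if_splits)
qed

lemma edges_in_pin: "edges_in V E \<Longrightarrow> edges_in (V - {v}) (pin v t E)"
  by (fastforce simp: edges_in_def pin_edge_def split: if_splits)

lemma edges_in_append [simp]: "edges_in V (E @ F) \<longleftrightarrow> edges_in V E \<and> edges_in V F"
  unfolding edges_in_def set_append ball_Un ..

lemma edges_in_Cons [simp]: "edges_in V (e # F) \<longleftrightarrow> set (snd (snd e)) \<subseteq> V \<and> edges_in V F"
  by (auto simp: edges_in_def split: prod.splits)

lemma edges_in_rev [simp]: "edges_in V (rev E) \<longleftrightarrow> edges_in V E"
  by (auto simp: edges_in_def)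

lemma good_posw: "good s D E \<Longrightarrow> s < 1 \<Longrightarrow> posw E"
  by (force simp: good_def posw_def)

section \<open>Accuracy of the bounds\<close>

definition bounds :: "bool \<Rightarrow> real \<Rightarrow> real \<Rightarrow> bool" where
  "bounds up x y \<longleftrightarrow> (if up then y \<le> x else x \<le> y)"

lemma bounds_mult: "bounds up x y \<Longrightarrow> bounds up x' y' \<Longrightarrow> 0 \<le> x \<Longrightarrow> 0 \<le> x' \<Longrightarrow> 0 \<le> y \<Longrightarrow> 0 \<le> y'
    \<Longrightarrow> bounds up (x * x') (y * y')"
  by (auto simp: bounds_def mult_mono)

lemma bounds_refl [simp]: "bounds up x x"
  by (simp add: bounds_def)

text \<open>The probability of spin 1 grows with the odds and that of spin 0 falls, so the direction
  flips exactly when \<open>s\<close> is \<open>False\<close>.\<close>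

lemma bounds_dirsel:
  "bounds up x y \<Longrightarrow> 0 < x \<Longrightarrow> 0 < y \<Longrightarrow> bounds (up = s) (spin_prob s x) (spin_prob s y)"
  by (auto simp: bounds_def spin_prob_def field_simps split: if_splits)

lemma spin_prob_range: "0 < x \<Longrightarrow> 0 < spin_prob s x \<and> spin_prob s x < 1"
  by (auto simp: spin_prob_def)

text \<open>The a priori range keeps the computed marginals below a constant less than 1, as needed
  for the decay of \<open>kappa\<close> in the size of a hyperedge. The condition
  \<open>B < X\<close> expresses that the depth suffices for the budget.\<close>

definition accurate :: "real \<Rightarrow> real \<Rightarrow> nat \<Rightarrow> real \<Rightarrow> real \<Rightarrow> real \<Rightarrow> approx \<Rightarrow> bool" where
  "accurate lam s D C c X m \<longleftrightarrow> (\<forall>V A u B. finite V \<longrightarrow> u \<in> V \<longrightarrow> edges_in V A \<longrightarrow> good s D A \<longrightarrow>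
     0 < B \<longrightarrow> B < X \<longrightarrow>
     lam / 3 ^ D \<le> m A u B False \<and> m A u B False \<le> odds lam V A u \<and> odds lam V A u \<le> m A u B True \<and>
     m A u B True \<le> lam * 3 ^ D \<and> ln (m A u B True) - ln (m A u B False) \<le> C * B powr (- c))"

text \<open>The origin of \<open>s / (1 - s)\<close>: it bounds \<open>a / (1 - a * x)\<close>, the
  absolute slope of the logarithm, over all \<open>a \<le> s\<close> and
  \<open>x \<le> 1\<close>.\<close>

lemma ln_one_minus_diff:
  fixes a s x y :: real
  assumes "0 \<le> a" "a \<le> s" "s < 1" "0 \<le> x" "x \<le> y" "y \<le> 1"
  shows "ln (1 - a * x) - ln (1 - a * y) \<le> s / (1 - s) * (y - x)"
proof -
  have "a * x \<le> a * y" "a * y \<le> s * 1"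
    using assms by (auto intro!: mult_left_mono mult_mono simp del: mult_1_right)
  then have pos: "1 - s \<le> 1 - a * y" "1 - a * y \<le> 1 - a * x" by auto
  then have "ln (1 - a * x) - ln (1 - a * y) \<le> ((1 - a * x) - (1 - a * y)) / (1 - a * y)"
    using assms by (intro ln_diff_le) auto
  also have "\<dots> = (a * (y - x)) / (1 - a * y)" by (simp add: algebra_simps)
  also have "\<dots> \<le> (s * (y - x)) / (1 - s)"
    using assms pos by (intro frac_le mult_right_mono) auto
  finally show ?thesis by simp
qed

lemma pin_factor_bounds:
  fixes s :: real
  assumes "0 \<le> a" "a \<le> s" "s \<le> 2 / 3" "0 \<le> p" "p \<le> 1"
  shows "1 / 3 \<le> 1 - a * p" "1 - a * p \<le> 1"
proof -
  have "a * p \<le> 2 / 3 * 1" using assms by (intro mult_mono) auto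
  then show "1 / 3 \<le> 1 - a * p" by simp
qed (use assms in simp)

text \<open>One level of the recursion, with the recursive call abstracted to \<open>m\<close>. Here
  \<eta> bounds the probability of either spin over the whole range of odds. The same setting serves
  the running time, where the program divides by computed quantities.\<close>

locale approximation =
  fixes lam s :: real and D :: nat and C c X :: real and m :: approx and \<eta> :: real
  assumes lam: "lam > 0" and s: "0 \<le> s" "s \<le> 2 / 3" and C: "0 \<le> C"
    and acc: "accurate lam s D C c X m"
    and eta: "lam * 3 ^ D / (1 + lam * 3 ^ D) \<le> \<eta>" "1 / (1 + lam / 3 ^ D) \<le> \<eta>" "\<eta> < 1"
begin

lemma m_props:
  assumes "finite V" "u \<in> V" "edges_in V A" "good s D A" "0 < B" "B < X"
  shows "lam / 3 ^ D \<le> m A u B up" "m A u B up \<le> lam * 3 ^ D" "0 < m A u B up"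
    "m A u B False \<le> m A u B True" "bounds up (m A u B up) (odds lam V A u)"
    "ln (m A u B True) - ln (m A u B False) \<le> C * B powr (- c)"
proof -
  note * = acc[unfolded accurate_def, rule_format, OF assms]
  show 1: "lam / 3 ^ D \<le> m A u B up" using * by (cases up) auto
  have "0 < lam / 3 ^ D" using lam by simp
  then show "0 < m A u B up" using 1 by linarith
  show "m A u B up \<le> lam * 3 ^ D" using * by (cases up) auto
qed (use acc[unfolded accurate_def, rule_format, OF assms] in \<open>auto simp: bounds_def\<close>)

lemma block_bounds:
  assumes "finite V" "set S \<subseteq> V" "distinct S" "edges_in V A" "good s D A" "0 < B" "B < X"
  shows "bounds (up = t) (block m t B up A S) (chain lam t V A S)" (is ?A)
    and "0 \<le> block m t B up A S" "block m t B up A S \<le> 1"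
    and "0 \<le> chain lam t V A S" "chain lam t V A S \<le> 1"
proof -
  have "?A \<and> 0 \<le> block m t B up A S \<and> block m t B up A S \<le> 1 \<and>
     0 \<le> chain lam t V A S \<and> chain lam t V A S \<le> 1"
    using assms
  proof (induction S arbitrary: V A)
    case Nil
    then show ?case by (simp add: block_def)
  next
    case (Cons u us)
    note mp = m_props[of V u A B, OF _ _ _ _ Cons.prems(6,7)]
    have odds: "odds lam V A u > 0" using Cons.prems lam s good_posw by (intro odds_pos) auto
    have IH: "bounds (up = t) (block m t B up (pin u t A) us) (chain lam t (V - {u}) (pin u t A) us) \<and>
      0 \<le> block m t B up (pin u t A) us \<and> block m t B up (pin u t A) us \<le> 1 \<and>
      0 \<le> chain lam t (V - {u}) (pin u t A) us \<and> chain lam t (V - {u}) (pin u t A) us \<le> 1"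
      using Cons.prems s by (intro Cons.IH) (auto intro: edges_in_pin good_pin)
    have b: "block m t B up A (u # us) = spin_prob t (m A u B up) * block m t B up (pin u t A) us"
      by (simp add: block_def)
    have d: "bounds (up = t) (spin_prob t (m A u B up)) (spin_prob t (odds lam V A u))"
      using Cons.prems odds by (intro bounds_dirsel mp) auto
    have r: "0 < spin_prob t (m A u B up)" "spin_prob t (m A u B up) < 1"
      "0 < spin_prob t (odds lam V A u)" "spin_prob t (odds lam V A u) < 1"
      using spin_prob_range[OF odds] spin_prob_range mp(3) Cons.prems by auto
    show ?case unfolding b using d r IH
      by (auto intro!: bounds_mult mult_le_one)
  qed
  then show ?A "0 \<le> block m t B up A S" "block m t B up A S \<le> 1"
    "0 \<le> chain lam t V A S" "chain lam t V A S \<le> 1" by auto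
qed

lemma length_ratios [simp]: "length (ratios f t B up A S) = length S"
  by (induction S arbitrary: A) auto

lemma ratios_zip:
  assumes "finite V" "set S \<subseteq> V" "distinct S" "edges_in V A" "good s D A" "0 < B" "B < X"
    and "(l, h) \<in> set (zip (ratios m t B False A S) (ratios m t B True A S))"
  shows "lam / 3 ^ D \<le> l \<and> l \<le> h \<and> h \<le> lam * 3 ^ D \<and> ln h - ln l \<le> C * B powr (- c)"
  using assms
proof (induction S arbitrary: V A)
  case (Cons u us)
  show ?case
  proof (cases "(l, h) = (m A u B False, m A u B True)")
    case True
    then show ?thesis using m_props[of V u A B] Cons.prems by auto
  next
    case False
    then have "(l, h) \<in> set (zip (ratios m t B False (pin u t A) us) (ratios m t B True (pin u t A) us))"
      using Cons.prems by auto
    then show ?thesis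
      using Cons.prems s by (intro Cons.IH[of "V - {u}" "pin u t A"]) (auto intro: edges_in_pin good_pin)
  qed
qed simp

lemma block_diff:
  assumes "finite V" "set S \<subseteq> V" "distinct S" "edges_in V A" "good s D A" "0 < B" "B < X"
  shows "(block m True B True A S - block m True B False A S) +
     (block m False B False A S - block m False B True A S) \<le> kappa \<eta> (length S) * (C * B powr (- c))"
proof -
  define zs where "zs t = zip (ratios m t B False A S) (ratios m t B True A S)" for t
  have m: "map (f \<circ> fst) (zs t) = map f (ratios m t B False A S)"
    "map (f \<circ> snd) (zs t) = map f (ratios m t B True A S)" for f :: "real \<Rightarrow> real" and t
    unfolding map_map[symmetric] zs_def by simp_all
  have "(prod_list (map (spin_prob True \<circ> snd) (zs True)) - prod_list (map (spin_prob True \<circ> fst) (zs True))) +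
    (prod_list (map (spin_prob False \<circ> fst) (zs False)) - prod_list (map (spin_prob False \<circ> snd) (zs False)))
     \<le> kappa \<eta> (length S) * (C * B powr (- c))"
  proof (rule contraction[where a = "lam / 3 ^ D" and b = "lam * 3 ^ D"])
    \<comment> \<open>The first ratio is computed before anything is pinned, so it does not depend
      on the spin.\<close>
    show "0 < length S \<Longrightarrow> hd (zs True) = hd (zs False)"
      by (cases S) (auto simp: zs_def)
  qed (use ratios_zip[OF assms] lam eta C in \<open>auto simp: zs_def\<close>)
  then show ?thesis by (simp add: m block_def)
qed

lemma factor_props:
  assumes "finite V" "set S \<subseteq> V" "distinct S" "edges_in V A" "good s D A" "0 < B" "B < X"
    and e: "edge_ok s (b, g, S0)"
  shows "bounds up (factor m B up A (b, g, S0) S) (part_sum lam V ((1, g, S) # A) / part_sum lam V ((b, 1, S) # A))"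
    and "1 / 3 \<le> factor m B up A (b, g, S0) S" "factor m B up A (b, g, S0) S \<le> 3"
    and "ln (factor m B True A (b, g, S0) S) - ln (factor m B False A (b, g, S0) S)
      \<le> s / (1 - s) * kappa \<eta> (length S) * (C * B powr (- c))"
proof -
  note bb = block_bounds[OF assms(1-7)]
  have bg: "0 \<le> 1 - b" "1 - b \<le> s" "0 \<le> 1 - g" "1 - g \<le> s" using e by (auto simp: edge_ok_def)
  define P where "P up = block m True B up A S" for up
  define Q where "Q up = block m False B up A S" for up
  define p where "p = chain lam True V A S"
  define q where "q = chain lam False V A S"
  have P: "0 \<le> P up" "P up \<le> 1" and Q: "0 \<le> Q up" "Q up \<le> 1" for up
    using bb by (auto simp: P_def Q_def)
  have pq: "0 \<le> p" "p \<le> 1" "0 \<le> q" "q \<le> 1" using bb by (auto simp: p_def q_def)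
  have cmp: "P False \<le> p" "p \<le> P True" "Q True \<le> q" "q \<le> Q False"
    using bb(1)[where t = True] bb(1)[where t = False]
    by (auto simp: P_def Q_def p_def q_def bounds_def split: if_splits)
  note fP = pin_factor_bounds[OF bg(3,4) s(2) P] and fQ = pin_factor_bounds[OF bg(1,2) s(2) Q]
  note fp = pin_factor_bounds[OF bg(3,4) s(2) pq(1,2)] and fq = pin_factor_bounds[OF bg(1,2) s(2) pq(3,4)]
  have f: "factor m B up A (b, g, S0) S = (1 - (1 - g) * P (\<not> up)) / (1 - (1 - b) * Q (\<not> up))" for up
    by (simp add: factor_def P_def Q_def)
  have posw: "posw A" using assms(5) s good_posw by auto
  then have Zpos: "part_sum lam V A > 0" using lam assms by (intro posw_Z)
  have ex: "part_sum lam V ((1, g, S) # A) / part_sum lam V ((b, 1, S) # A) = (1 - (1 - g) * p) / (1 - (1 - b) * q)"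
    using Z_chain_True[OF lam assms(1-3) posw, of g] Z_chain_False[OF lam assms(1-3) posw, of b] Zpos
    by (simp add: p_def q_def)
  show "bounds up (factor m B up A (b, g, S0) S) (part_sum lam V ((1, g, S) # A) / part_sum lam V ((b, 1, S) # A))"
  proof (cases up)
    case True
    have "(1 - (1 - g) * p) / (1 - (1 - b) * q) \<le> (1 - (1 - g) * P False) / (1 - (1 - b) * Q False)"
      using cmp bg fp(1) fQ(1)[of False] fq(1) fP(1)[of False]
      by (intro frac_le diff_left_mono mult_left_mono) auto
    then show ?thesis unfolding ex f by (simp add: bounds_def True)
  next
    case False
    have "(1 - (1 - g) * P True) / (1 - (1 - b) * Q True) \<le> (1 - (1 - g) * p) / (1 - (1 - b) * q)"
      using cmp bg fp(1) fQ(1)[of True] fq(1) fP(1)[of True]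
      by (intro frac_le diff_left_mono mult_left_mono) auto
    then show ?thesis unfolding ex f by (simp add: bounds_def False)
  qed
  have "(1 / 3) / 1 \<le> factor m B up A (b, g, S0) S" "factor m B up A (b, g, S0) S \<le> 1 / (1 / 3)"
  proof -
    note l = fP[of "\<not> up"] fQ[of "\<not> up"]
    show "(1 / 3) / 1 \<le> factor m B up A (b, g, S0) S"
      unfolding f by (rule frac_le) (use l in linarith)+
    show "factor m B up A (b, g, S0) S \<le> 1 / (1 / 3)"
      unfolding f by (rule frac_le) (use l in linarith)+
  qed
  then show "1 / 3 \<le> factor m B up A (b, g, S0) S" "factor m B up A (b, g, S0) S \<le> 3" by simp_all
  have pos: "0 < 1 - (1 - g) * P up" "0 < 1 - (1 - b) * Q up" for up
    using fP(1)[of up] fQ(1)[of up] by linarith+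
  have "ln (factor m B True A (b, g, S0) S) - ln (factor m B False A (b, g, S0) S)
    = (ln (1 - (1 - g) * P False) - ln (1 - (1 - g) * P True)) +
      (ln (1 - (1 - b) * Q True) - ln (1 - (1 - b) * Q False))"
    unfolding f using pos less_imp_neq[OF pos(1), symmetric] less_imp_neq[OF pos(2), symmetric]
    by (simp add: ln_div)
  also have "\<dots> \<le> s / (1 - s) * (P True - P False) + s / (1 - s) * (Q False - Q True)"
    using bg s P Q cmp by (intro add_mono ln_one_minus_diff) auto
  also have "\<dots> = s / (1 - s) * ((P True - P False) + (Q False - Q True))"
    by (rule distrib_left[symmetric])
  also have "\<dots> \<le> s / (1 - s) * (kappa \<eta> (length S) * (C * B powr (- c)))"
    using block_diff[OF assms(1-7)] s unfolding P_def Q_def by (intro mult_left_mono) auto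
  finally show "ln (factor m B True A (b, g, S0) S) - ln (factor m B False A (b, g, S0) S)
      \<le> s / (1 - s) * kappa \<eta> (length S) * (C * B powr (- c))" by (simp add: mult.assoc)
qed

end

lemma length_removeAll_distinct: "distinct S \<Longrightarrow> v \<in> set S \<Longrightarrow> length S = Suc (length (removeAll v S))"
  by (induction S) auto

context approximation begin

text \<open>The exact value \<open>x\<close> of the accumulator is generalized so that the factor of
  each processed hyperedge can be absorbed into it. The number \<xi> bounds the error of one
  hyperedge at \<open>v\<close> whatever its size \<open>k + 1\<close>, so the total error depends
  only on the degree.\<close>

lemma sweep_props:
  fixes \<xi> :: real
  assumes "finite V" "v \<notin> V" "edges_in V dn" "edges_in (insert v V) es" "good s D (rev dn @ es)"
    and B: "0 < B" "B < X"
    and xi: "\<And>k. s / (1 - s) * kappa \<eta> k * (C * (B / (real k + 1)) powr (- c)) \<le> \<xi>"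
    and "\<And>up. 0 < a up" "\<And>up. bounds up (a up) x" "0 < x"
  shows "bounds up (sweep m v B up dn es (a up))
           (x * part_sum lam V (dn @ pin v True es) / part_sum lam V (dn @ pin v False es)) \<and>
    a up / 3 ^ deg v es \<le> sweep m v B up dn es (a up) \<and>
    sweep m v B up dn es (a up) \<le> a up * 3 ^ deg v es \<and>
    ln (sweep m v B True dn es (a True)) - ln (sweep m v B False dn es (a False))
      \<le> ln (a True) - ln (a False) + deg v es * \<xi>"
  using assms(1-5,9-)
proof (induction es arbitrary: dn a x up)
  case Nil
  have "posw dn" using Nil s good_posw[of s D "rev dn"] by (auto simp: posw_def)
  then have "part_sum lam V dn > 0" using Nil lam by (intro posw_Z)
  then show ?case using Nil by simp
next
  case (Cons e es)
  obtain b g S where e: "e = (b, g, S)" by (cases e)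
  define e1 where "e1 = pin_edge v True (b, g, S)"
  have ok: "edge_ok s (b, g, S)" using Cons.prems by (simp add: good_alt e)
  then have dS: "distinct S" by (simp add: edge_ok_def)
  have good: "good s D (rev dn @ pin v False es)" "good s D (rev (e1 # dn) @ es)"
    unfolding e1_def by (rule good_step[OF Cons.prems(5)[unfolded e] s(1)])+
  have in1: "edges_in V (e1 # dn)" using Cons.prems by (auto simp: e1_def e)
  have in2: "edges_in (insert v V) es" using Cons.prems by auto
  show ?case
  proof (cases "v \<in> set S")
    case False
    then have e1: "e1 = e" by (simp add: e1_def pin_edge_def e)
    have f: "pin_edge v t e = e" for t using False by (simp add: pin_edge_def e)
    have "part_sum lam V ((e1 # dn) @ pin v t es) = part_sum lam V (dn @ pin v t (e # es))" for t
      by (rule Z_mset) (simp add: f e1)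
    then show ?thesis
      using Cons.IH[OF Cons.prems(1,2) in1 in2 good(2) Cons.prems(6-8), of up] False
      by (simp add: e e1_def)
  next
    case True
    define S' where "S' = removeAll v S"
    define A where "A = rev dn @ pin v False es"
    define B' where "B' = B / length S"
    have len: "real (length S) = real (length S') + 1"
      using length_removeAll_distinct[OF dS True] by (simp add: S'_def)
    have B': "0 < B'" "B' < X"
    proof -
      have "B' \<le> B / 1" unfolding B'_def len using B by (intro divide_left_mono) auto
      then show "0 < B'" "B' < X" using B by (auto simp: B'_def len)
    qed
    have A: "edges_in V A" using Cons.prems edges_in_pin[OF in2, of v False] by (simp add: A_def)
    have S': "set S' \<subseteq> V" "distinct S'" using Cons.prems dS by (auto simp: S'_def e distinct_removeAll)
    note fp = factor_props[OF Cons.prems(1) S' A good(1)[folded A_def] B' ok]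
    define F where "F up = factor m B' up A (b, g, S) S'" for up
    define y where "y = part_sum lam V ((1, g, S') # A) / part_sum lam V ((b, 1, S') # A)"
    have e1: "e1 = (1, g, S')" using True by (simp add: e1_def pin_edge_def S'_def)
    have p: "0 < b" "0 < g" using ok s by (auto simp: edge_ok_def)
    have posA: "posw A" using good(1) s good_posw by (auto simp: A_def)
    have Zp: "part_sum lam V ((1, g, S') # A) > 0" "part_sum lam V ((b, 1, S') # A) > 0"
      using p posA lam Cons.prems by (intro posw_Z; auto simp: posw_def)+
    have F: "0 < F up" for up using fp(2)[of up] by (simp add: F_def)
    have y: "0 < y" using Zp by (simp add: y_def)
    have pos': "0 < a up * F up" for up using Cons.prems F by simp
    have bd: "bounds up (a up * F up) (x * y)" for up
      using Cons.prems F y fp(1) by (intro bounds_mult) (auto simp: F_def y_def less_imp_le)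
    have sw: "sweep m v B up dn (e # es) (a up) = sweep m v B up (e1 # dn) es (a up * F up)" for up
      using True by (simp add: e e1_def F_def A_def B'_def S'_def)
    note IH = Cons.IH[OF Cons.prems(1,2) in1 in2 good(2), of "\<lambda>up. a up * F up" "x * y" up,
      OF pos' bd mult_pos_pos[OF Cons.prems(8) y], folded sw]
    have Z1: "part_sum lam V ((1, g, S') # A) = part_sum lam V ((e1 # dn) @ pin v False es)"
      by (rule Z_mset) (simp add: e1 A_def)
    have Z2: "part_sum lam V ((b, 1, S') # A) = part_sum lam V (dn @ pin v False (e # es))"
      by (rule Z_mset) (use True in \<open>simp add: A_def e pin_edge_def S'_def\<close>)
    have Z3: "part_sum lam V ((e1 # dn) @ pin v True es) = part_sum lam V (dn @ pin v True (e # es))"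
      by (rule Z_mset) (simp add: e e1_def)
    \<comment> \<open>This is the telescoping: by \<open>Z1\<close> the numerator of
      \<open>y\<close> is the denominator of the ratio left for \<open>es\<close>.\<close>
    have ex: "x * y * part_sum lam V ((e1 # dn) @ pin v True es) / part_sum lam V ((e1 # dn) @ pin v False es)
      = x * part_sum lam V (dn @ pin v True (e # es)) / part_sum lam V (dn @ pin v False (e # es))"
      using Zp unfolding y_def Z1 Z2 Z3 by simp
    have deg: "deg v (e # es) = Suc (deg v es)" using True by (simp add: e)
    have "a up / 3 ^ deg v (e # es) \<le> a up * F up / 3 ^ deg v es"
      using fp(2)[of up] Cons.prems(6)[of up] by (simp add: F_def deg field_simps del: deg_simps)
    moreover have "a up * F up * 3 ^ deg v es \<le> a up * 3 ^ deg v (e # es)"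
      using fp(3)[of up] Cons.prems(6)[of up] by (simp add: F_def deg field_simps del: deg_simps)
    moreover have "ln (a up * F up) = ln (a up) + ln (F up)" for up
      using F[of up] Cons.prems(6)[of up] by (simp add: ln_mult)
    moreover have "ln (F True) - ln (F False) \<le> \<xi>"
      using fp(4) xi[of "length S'"] by (simp add: F_def B'_def len)
    ultimately show ?thesis using IH unfolding ex
      by (auto simp: deg algebra_simps simp del: deg_simps)
  qed
qed

end

section \<open>Trivial bounds and induction on the depth\<close>

lemma ew_pin_le:
  assumes "edge_ok s e" "s \<le> 2 / 3"
  shows "edge_wt (pin_edge v t e) T \<le> (if v \<in> set (snd (snd e)) then 3 else 1) * edge_wt (pin_edge v (\<not> t) e) T"
    and "0 < edge_wt (pin_edge v t e) T"
  using assms by (cases e; cases t; auto simp: edge_ok_def pin_edge_def edge_wt_def)+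

text \<open>Flipping the spin of \<open>v\<close> alters only the weights of the hyperedges at
  \<open>v\<close>, each by a factor of at most 3 since they lie between 1/3 and 1.\<close>

lemma Z_pin_le:
  assumes "\<forall>e\<in>set E. edge_ok s e" "s \<le> 2 / 3" "0 < lam"
  shows "part_sum lam V (pin v t E) \<le> 3 ^ deg v E * part_sum lam V (pin v (\<not> t) E)"
proof -
  have "prod_list (map (\<lambda>e. edge_wt e T) (pin v t E)) \<le> 3 ^ deg v E * prod_list (map (\<lambda>e. edge_wt e T) (pin v (\<not> t) E))
     \<and> 0 < prod_list (map (\<lambda>e. edge_wt e T) (pin v t E))" for T
    using assms(1)
  proof (induction E)
    case (Cons e E)
    let ?k = "if v \<in> set (snd (snd e)) then 3 else 1 :: real"
    have e: "edge_wt (pin_edge v t e) T \<le> ?k * edge_wt (pin_edge v (\<not> t) e) T" "0 < edge_wt (pin_edge v t e) T"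
      using Cons.prems assms(2) by (intro ew_pin_le[where s = s]; simp)+
    have "edge_wt (pin_edge v t e) T * prod_list (map (\<lambda>e. edge_wt e T) (pin v t E)) \<le>
      (?k * edge_wt (pin_edge v (\<not> t) e) T) * (3 ^ deg v E * prod_list (map (\<lambda>e. edge_wt e T) (pin v (\<not> t) E)))"
      using Cons e by (intro mult_mono) (auto intro: order_trans less_imp_le)
    then show ?case using e Cons by (auto simp: mult_ac)
  qed simp
  then show ?thesis
    unfolding part_sum_def sum_distrib_left mult.left_commute[of "3 ^ _"] using assms(3)
    by (intro sum_mono mult_left_mono) auto
qed

lemma odds_range:
  assumes "good s D E" "s \<le> 2 / 3" "0 < lam" "finite V"
  shows "lam / 3 ^ deg v E \<le> odds lam V E v" "odds lam V E v \<le> lam * 3 ^ deg v E"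
proof -
  have ok: "\<forall>e\<in>set E. edge_ok s e" using assms by (simp add: good_alt)
  have "posw E" using assms good_posw by auto
  then have "0 < part_sum lam (V - {v}) (pin v False E)" using assms by (intro posw_Z) auto
  then show "lam / 3 ^ deg v E \<le> odds lam V E v" "odds lam V E v \<le> lam * 3 ^ deg v E"
    unfolding odds_def
    using Z_pin_le[OF ok assms(2,3), of "V - {v}" v True] Z_pin_le[OF ok assms(2,3), of "V - {v}" v False] assms(3)
    by (simp_all add: field_simps)
qed

text \<open>At a leaf \<open>B < 1\<close>, so \<open>B powr (- c)\<close> is at least 1 and
  \<open>C\<close> only has to cover the width of the trivial interval. At an inner call, dividing
  the budget inflates the error of the children by \<open>(4 * 3 ^ d * (k + 1)) powr c\<close>; by
  \<open>decay\<close> every hyperedge still contributes at most a fraction \<theta> of the allowed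
  error, and there are at most \<open>D\<close> of them.\<close>

lemma marg_accurate:
  assumes lam: "lam > 0" and s: "0 \<le> s" "s \<le> 2 / 3" and c: "0 < c" and C: "2 * real D * ln 3 \<le> C"
    and eta: "lam * 3 ^ D / (1 + lam * 3 ^ D) \<le> \<eta>" "1 / (1 + lam / 3 ^ D) \<le> \<eta>" "\<eta> < 1"
    and decay: "\<And>k::nat. s / (1 - s) * kappa \<eta> k * (4 * 3 ^ D * (real k + 1)) powr c \<le> \<theta>"
    and \<theta>: "real D * \<theta> \<le> 1"
  shows "accurate lam s D C c (4 ^ n) (marg lam n)"
proof (induction n)
  have C0: "0 \<le> C" using C by (smt (verit) ln_gt_zero mult_nonneg_nonneg of_nat_0_le_iff)
  have leaf: "lam / 3 ^ D \<le> lam / 3 ^ d" "lam * 3 ^ d \<le> lam * 3 ^ D"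
     "ln (lam * 3 ^ d) - ln (lam / 3 ^ d) \<le> C" if "d \<le> D" for d
  proof -
    have p: "(3::real) ^ d \<le> 3 ^ D" using that by (intro power_increasing) auto
    then show "lam / 3 ^ D \<le> lam / 3 ^ d" "lam * 3 ^ d \<le> lam * 3 ^ D"
      using lam by (auto intro!: divide_left_mono)
    have "ln (lam * 3 ^ d) - ln (lam / 3 ^ d) = 2 * real d * ln 3"
      using lam by (simp add: ln_mult ln_div ln_realpow)
    also have "\<dots> \<le> 2 * real D * ln 3" using that by (intro mult_right_mono) auto
    finally show "ln (lam * 3 ^ d) - ln (lam / 3 ^ d) \<le> C" using C by linarith
  qed
  have leaf_case: "lam / 3 ^ D \<le> lam / 3 ^ deg u A \<and> lam / 3 ^ deg u A \<le> odds lam V A u \<and>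
     odds lam V A u \<le> lam * 3 ^ deg u A \<and> lam * 3 ^ deg u A \<le> lam * 3 ^ D \<and>
     ln (lam * 3 ^ deg u A) - ln (lam / 3 ^ deg u A) \<le> C * B powr (- c)"
    if "finite V" "good s D A" "0 < B" "B < 1" for V A u and B :: real
  proof -
    have d: "deg u A \<le> D" using that by (simp add: good_alt)
    have "1 powr c \<ge> B powr c" using that c by (intro powr_mono2) auto
    then have "1 \<le> B powr (- c)" using that by (simp add: powr_minus field_simps)
    then have "C * 1 \<le> C * B powr (- c)" using C0 by (intro mult_left_mono) auto
    then show ?thesis using leaf[OF d] odds_range[OF that(2) s(2) lam that(1)] by auto
  qed
  {
    case 0
    then show ?case unfolding accurate_def using leaf_case by auto
  next
    case (Suc n)
    interpret approximation lam s D C c "4 ^ n" "marg lam n" \<eta>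
      using lam s C0 Suc eta by unfold_locales
    show ?case unfolding accurate_def
    proof (intro allI impI)
      fix V :: "nat set" and A u and B :: real
      assume V: "finite V" "u \<in> V" "edges_in V A" "good s D A" "0 < B" "B < 4 ^ Suc n"
      show "lam / 3 ^ D \<le> marg lam (Suc n) A u B False \<and>
         marg lam (Suc n) A u B False \<le> odds lam V A u \<and>
         odds lam V A u \<le> marg lam (Suc n) A u B True \<and>
         marg lam (Suc n) A u B True \<le> lam * 3 ^ D \<and>
         ln (marg lam (Suc n) A u B True) - ln (marg lam (Suc n) A u B False) \<le> C * B powr - c"
      proof (cases "B < 1")
        case True
        then show ?thesis using leaf_case[OF V(1,4,5)] by auto
      next
        case False
        define d where "d = deg u A"
        have d: "d \<le> D" using V by (simp add: d_def good_alt)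
        define B' where "B' = B / (4 * 3 ^ d)"
        \<comment> \<open>The budget falls at least by the factor 4, which is what one level of
          depth is worth in the bound \<open>4 ^ n\<close>.\<close>
        have "B' \<le> B / (4 * 1)" unfolding B'_def using V by (intro divide_left_mono mult_left_mono) auto
        then have B': "0 < B'" "B' < 4 ^ n" using V by (auto simp: B'_def)
        have xi: "s / (1 - s) * kappa \<eta> k * (C * (B' / (real k + 1)) powr - c) \<le> \<theta> * C * B powr (- c)" for k
        proof -
          have "(4 * 3 ^ d * (real k + 1)) powr c \<le> (4 * 3 ^ D * (real k + 1)) powr c"
            using c d by (intro powr_mono2 mult_right_mono mult_left_mono power_increasing) auto
          moreover have k0: "0 \<le> s / (1 - s) * kappa \<eta> k"
          proof -
            have "0 \<le> \<eta>" using eta(2) lam by (smt (verit) divide_nonneg_nonneg zero_le_power)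
            then show ?thesis using s by (intro mult_nonneg_nonneg kappa_nonneg) auto
          qed
          ultimately have "s / (1 - s) * kappa \<eta> k * (4 * 3 ^ d * (real k + 1)) powr c \<le> \<theta>"
            using decay[of k] by (meson mult_left_mono order_trans)
          then have "(s / (1 - s) * kappa \<eta> k * (4 * 3 ^ d * (real k + 1)) powr c) * (C * B powr (- c))
            \<le> \<theta> * (C * B powr (- c))"
            using C0 by (intro mult_right_mono) auto
          moreover have "(B' / (real k + 1)) powr (- c) = (4 * 3 ^ d * (real k + 1)) powr c * B powr (- c)"
          proof -
            have "B' / (real k + 1) = B / (4 * 3 ^ d * (real k + 1))" by (simp add: B'_def)
            then show ?thesis using V
              by (simp only:) (simp add: powr_divide powr_minus_divide)
          qed
          ultimately show ?thesis by (simp add: mult_ac)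
        qed
        have E: "edges_in (insert u (V - {u})) A" "good s D (rev [] @ A)"
          using V by (simp_all add: insert_absorb)
        have lk: "edges_in (V - {u}) []" by (simp add: edges_in_def)
        have nu: "u \<notin> V - {u}" by simp
        note sp = sweep_props[where a = "\<lambda>_. lam" and x = lam,
            OF finite_Diff[OF V(1)] nu lk E B' xi lam bounds_refl lam]
        have sw: "marg lam (Suc n) A u B up = sweep (marg lam n) u B' up [] A lam" for up
          using False by (simp add: B'_def d_def)
        have bd: "bounds up (marg lam (Suc n) A u B up) (odds lam V A u)"
            "lam / 3 ^ d \<le> marg lam (Suc n) A u B up" "marg lam (Suc n) A u B up \<le> lam * 3 ^ d" for up
          unfolding sw odds_def d_def using sp[of up] by auto
        have "ln (marg lam (Suc n) A u B True) - ln (marg lam (Suc n) A u B False)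
           \<le> d * (\<theta> * C * B powr (- c))"
          unfolding sw d_def using sp[of True] by auto
        also have "\<dots> = (d * \<theta>) * (C * B powr (- c))" by simp
        also have "\<dots> \<le> 1 * (C * B powr (- c))"
        proof (intro mult_right_mono)
          have "0 \<le> \<theta>"
          proof -
            have "0 \<le> \<eta>" using eta(2) lam by (smt (verit) divide_nonneg_nonneg zero_le_power)
            then have "0 \<le> s / (1 - s) * kappa \<eta> 0 * (4 * 3 ^ D * (real 0 + 1)) powr c"
              using s by (intro mult_nonneg_nonneg kappa_nonneg) auto
            then show ?thesis using decay[of 0] by simp
          qed
          then have "real d * \<theta> \<le> real D * \<theta>" using d by (intro mult_right_mono) auto
          then show "real d * \<theta> \<le> 1" using \<theta> by linarith
        qed (use C0 in auto)
        finally show ?thesis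
          using bd[of True] bd[of False] leaf(1,2)[OF d] by (auto simp: bounds_def)
      qed
    qed
  }
qed

lemma marg_accurate_exists:
  fixes lam s :: real and D :: nat
  assumes lam: "lam > 0" and s: "s = 2 / (2 * exp (- 1 / 2) * real D + 3)"
  shows "\<exists>C>0. \<exists>c>0. \<forall>n. accurate lam s D C c (4 ^ n) (marg lam n)"
proof -
  define x where "x = exp (- 1 / 2 :: real)"
  have x: "0 < x" by (simp add: x_def)
  have "s = 2 / (2 * x * real D + 3)" unfolding s x_def ..
  then have s01: "0 \<le> s" "s \<le> 2 / 3"
    using x frac_le[of 2 2 3 "2 * x * real D + 3"] by auto
  define \<eta> where "\<eta> = max (lam * 3 ^ D / (1 + lam * 3 ^ D)) (1 / (1 + lam / 3 ^ D))"
  have "lam * 3 ^ D > 0" "lam / 3 ^ D > 0" using lam by auto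
  then have eta: "lam * 3 ^ D / (1 + lam * 3 ^ D) \<le> \<eta>" "1 / (1 + lam / 3 ^ D) \<le> \<eta>" "\<eta> < 1"
    by (auto simp: \<eta>_def)
  have eta0: "0 \<le> \<eta>" using eta(2) lam by (smt (verit) divide_nonneg_nonneg zero_le_power)
  \<comment> \<open>Chosen strictly above
    \<open>s / (1 - s) * exp (- 1 / 2) = 2 * x / (2 * x * D + 1)\<close>, as the choice of the
    exponent requires, while \<open>D * \<theta>\<close> stays below 1; hence 1/2 in place of
    1.\<close>
  define \<theta> where "\<theta> = 2 * x / (2 * x * real D + 1 / 2)"
  have tau: "s / (1 - s) = 2 / (2 * x * real D + 1)"
  proof -
    have p: "2 * x * real D + 3 > 0" "2 * x * real D + 1 > 0" using x by (auto intro!: add_nonneg_pos)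
    define y where "y = 2 * x * real D + 3"
    have y: "y > 2" using p unfolding y_def by linarith
    then have "1 - 2 / y = (y - 2) / y" by (simp add: diff_divide_distrib)
    then have "(2 / y) / (1 - 2 / y) = 2 / (y - 2)" using y by simp
    then show ?thesis unfolding s x_def[symmetric] by (simp add: y_def)
  qed
  have "2 / (2 * x * real D + 1) * x < \<theta>"
  proof -
    have "2 * x / (2 * x * real D + 1) < 2 * x / (2 * x * real D + 1 / 2)"
      using x by (intro divide_strict_left_mono mult_pos_pos add_nonneg_pos) auto
    then show ?thesis by (simp add: \<theta>_def)
  qed
  moreover have "0 \<le> s / (1 - s)" using s01 by auto
  moreover have "(1::real) \<le> 4 * 3 ^ D" using one_le_power[of "3::real" D] by linarith
  ultimately obtain c where c: "c > 0"
      "\<And>k::nat. s / (1 - s) * kappa \<eta> k * (4 * 3 ^ D * (real k + 1)) powr c \<le> \<theta>"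
    using decay_exponent_exists[OF eta0 eta(3), of "s / (1 - s)" \<theta> "4 * 3 ^ D"]
    unfolding tau x_def[symmetric] by auto
  have "real D * \<theta> \<le> 1"
  proof -
    have "2 * x * real D + 1 / 2 > 0" using x by (auto intro!: add_nonneg_pos)
    then show ?thesis by (simp add: \<theta>_def field_simps)
  qed
  \<comment> \<open>The summand 1 keeps the constant positive when \<open>D = 0\<close>.\<close>
  then have "accurate lam s D (2 * real D * ln 3 + 1) c (4 ^ n) (marg lam n)" for n
    by (intro marg_accurate[OF lam s01 c(1) _ eta c(2)]) auto
  moreover have "2 * real D * ln 3 + 1 > 0" by (auto intro!: add_nonneg_pos)
  ultimately show ?thesis using c(1) by blast
qed

section \<open>Approximating the partition function\<close>

text \<open>Self-reducibility: the partition function is \<open>1 + odds\<close> times that of the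
  instance with \<open>v\<close> pinned to 0. When every vertex has been pinned to 0, a hyperedge
  that had vertices retains only its weight \<open>b\<close>.\<close>

primrec zval :: "real \<Rightarrow> nat \<Rightarrow> real \<Rightarrow> bool \<Rightarrow> edge list \<Rightarrow> nat list \<Rightarrow> real" where
  "zval lam n B up E [] = prod_list (map fst E)"
| "zval lam n B up E (v # vs) = (1 + marg lam n E v B up) * zval lam n B up (pin v False E) vs"

definition empty_weight :: "edge list \<Rightarrow> real" where
  "empty_weight E = prod_list (map (\<lambda>(b, g, S). if S = [] then g else 1) E)"

text \<open>A hyperedge emptied by pinning to 0 has its \<open>g\<close> replaced by 1, so exactly
  the hyperedges that were empty from the start count.\<close>

lemma empty_weight_pin: "empty_weight (pin v False E) = empty_weight E"
  unfolding empty_weight_def map_map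
  by (intro arg_cong[where f = prod_list] map_cong) (auto simp: pin_edge_def)

lemma zval_props:
  assumes lam: "lam > 0" and s: "0 \<le> s" "s \<le> 2 / 3" and acc: "accurate lam s D C c (4 ^ n) (marg lam n)"
    and B: "0 < B" "B < 4 ^ n" and "distinct vs" "edges_in (set vs) E" "good s D E"
  shows "bounds up (zval lam n B up E vs * empty_weight E) (part_sum lam (set vs) E) \<and> 0 < zval lam n B up E vs \<and>
     ln (zval lam n B True E vs) - ln (zval lam n B False E vs) \<le> length vs * (C * B powr (- c))"
  using assms(7-)
proof (induction vs arbitrary: E up)
  case Nil
  have "part_sum lam {} E = prod_list (map fst E) * empty_weight E"
    using Nil(2) unfolding part_sum_def empty_weight_def
    by (induction E) (auto simp: edge_wt_def)
  moreover have "prod_list (map fst E) > 0"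
  proof -
    have "\<forall>e\<in>set E. fst e > 0" using Nil(3) s by (force simp: good_def)
    then show ?thesis by (induction E) auto
  qed
  ultimately show ?case by simp
next
  case (Cons v vs)
  have sv: "insert v (set vs) - {v} = set vs" using Cons.prems by auto
  have pos: "0 < lam / 3 ^ D" using lam by simp
  note a = acc[unfolded accurate_def, rule_format, OF _ _ Cons.prems(2,3) B, of v, simplified]
  define m where "m up = marg lam n E v B up" for up
  define r where "r = odds lam (set (v # vs)) E v"
  have m: "0 < m False" "m False \<le> r" "r \<le> m True" "ln (m True) - ln (m False) \<le> C * B powr (- c)"
    using a pos unfolding m_def r_def by auto
  have m0: "0 < m up" for up using m by (cases up) auto
  have E': "edges_in (set vs) (pin v False E)" "good s D (pin v False E)"
    using edges_in_pin[OF Cons.prems(2), of v False] good_pin[OF Cons.prems(3) s(1)] Cons.prems(1) by auto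
  note IH = Cons.IH[OF _ E', simplified empty_weight_pin]
  have dv: "distinct vs" using Cons.prems by simp
  define z where "z up = zval lam n B up (pin v False E) vs" for up
  have z: "bounds up (z up * empty_weight E) (part_sum lam (set vs) (pin v False E))" "0 < z up"
    "ln (z True) - ln (z False) \<le> length vs * (C * B powr (- c))" for up
    using IH[OF dv] by (auto simp: z_def)
  have zv: "zval lam n B up E (v # vs) = (1 + m up) * z up" for up by (simp add: m_def z_def)
  have "posw E" using Cons.prems(3) s good_posw by auto
  then have Z0: "0 < part_sum lam (set vs) (pin v False E)" using lam by (intro posw_Z) auto
  have "0 < empty_weight E"
  proof -
    have "\<forall>e\<in>set E. fst (snd e) > 0" using Cons.prems(3) s by (force simp: good_def)
    then show ?thesis unfolding empty_weight_def by (induction E) auto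
  qed
  then have "0 \<le> z up * empty_weight E" using z(2)[of up] by simp
  moreover have "bounds up (1 + m up) (1 + r)" using m by (auto simp: bounds_def)
  moreover have r: "0 < r" using m by linarith
  ultimately have "bounds up ((1 + m up) * (z up * empty_weight E)) ((1 + r) * part_sum lam (set vs) (pin v False E))"
    using z(1)[of up] m0[of up] Z0 by (intro bounds_mult) auto
  moreover have "(1 + r) * part_sum lam (set vs) (pin v False E) = part_sum lam (set (v # vs)) E"
    using Z_insert[of "set vs" v lam E] Cons.prems(1) Z0 unfolding r_def odds_def
    by (simp add: sv field_simps)
  \<comment> \<open>As a function of \<open>y\<close>, \<open>ln (1 + exp y)\<close> is increasing
    and 1-Lipschitz, so passing from odds to \<open>1 + odds\<close> does not enlarge the
    logarithmic error.\<close>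
  moreover have "ln (1 + m True) - ln (1 + m False) \<le> ln (m True) - ln (m False)"
  proof -
    have "(1 + m True) * m False \<le> m True * (1 + m False)" using m by (simp add: algebra_simps)
    then have "(1 + m True) / (1 + m False) \<le> m True / m False"
      using m(1) by (simp add: divide_simps)
    then have "ln ((1 + m True) / (1 + m False)) \<le> ln (m True / m False)"
      using m0 by (subst ln_le_cancel_iff) (auto intro!: divide_pos_pos add_pos_pos)
    then show ?thesis using m0[of True] m0[of False] by (simp add: ln_div)
  qed
  moreover have "ln ((1 + m up) * z up) = ln (1 + m up) + ln (z up)" for up
    using m0[of up] z(2)[of up] by (simp add: ln_mult)
  moreover have "0 < (1 + m up) * z up" using m0[of up] z(2)[of up] by simp
  ultimately show ?case using z(3) m(4) unfolding zv by (auto simp: algebra_simps)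
qed

section \<open>Instances as edge lists\<close>

definition edge_of :: "nat spin_instance \<Rightarrow> nat list \<Rightarrow> edge" where
  "edge_of G xs = (beta_wt G (set xs), gamma_wt G (set xs), xs)"

lemma ew_edge_of:
  assumes "T \<subseteq> V" "set xs \<subseteq> V"
  shows "edge_weight G (set xs) (restrict (\<lambda>v. if v \<in> T then 1 else 0) V) *
      (if xs = [] then gamma_wt G (set xs) else 1) = edge_wt (edge_of G xs) T"
proof (cases xs)
  case Nil
  then show ?thesis by (simp add: edge_weight_def edge_wt_def edge_of_def)
next
  case (Cons y ys)
  have "restrict (\<lambda>v. if v \<in> T then 1 else 0 :: nat) V v = (if v \<in> T then 1 else 0)" if "v \<in> set xs" for v
    using that assms by auto
  then have 0: "(\<forall>v\<in>set xs. restrict (\<lambda>v. if v \<in> T then 1 else 0 :: nat) V v = 0) \<longleftrightarrow> set xs \<inter> T = {}"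
    and 1: "(\<forall>v\<in>set xs. restrict (\<lambda>v. if v \<in> T then 1 else 0 :: nat) V v = 1) \<longleftrightarrow> set xs \<subseteq> T"
    by auto
  have "y \<in> set xs" using Cons by simp
  then have "\<not> (set xs \<inter> T = {} \<and> set xs \<subseteq> T)" by blast
  then show ?thesis unfolding edge_weight_def 0 1 by (auto simp: edge_wt_def edge_of_def Cons)
qed

lemma prod_list_map_mult:
  "prod_list (map f xs) * prod_list (map g xs) = prod_list (map (\<lambda>x. f x * g x :: real) xs)"
  by (induction xs) (auto simp: algebra_simps)

lemma partition_fun_eq_Z:
  assumes "listing G vs es" "valid_instance G"
  shows "partition_fun lam G * empty_weight (map (edge_of G) es) = part_sum lam (set vs) (map (edge_of G) es)"
proof -
  let ?V = "verts G"
  let ?f = "\<lambda>T. restrict (\<lambda>v. if v \<in> T then 1 else 0 :: nat) ?V"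
  have V: "set vs = ?V" "finite ?V" using assms by (auto simp: listing_def valid_instance_def)
  have es: "distinct (map set es)" "set ` set es = hedges G" using assms by (auto simp: listing_def)
  have sub: "set xs \<subseteq> ?V" if "xs \<in> set es" for xs
    using that es assms by (auto simp: valid_instance_def)
  have "partition_fun lam G = (\<Sum>T\<in>Pow ?V. config_weight lam G (?f T))"
    unfolding partition_fun_def
  proof (rule sum.reindex_bij_witness[where i = ?f and j = "\<lambda>\<sigma>. {v \<in> ?V. \<sigma> v = 1}"])
    fix \<sigma> assume \<sigma>: "\<sigma> \<in> ?V \<rightarrow>\<^sub>E {0, 1::nat}"
    show "?f {v \<in> ?V. \<sigma> v = 1} = \<sigma>"
    proof
      fix v show "?f {v \<in> ?V. \<sigma> v = 1} v = \<sigma> v"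
        using PiE_mem[OF \<sigma>, of v] PiE_arb[OF \<sigma>, of v] by (cases "v \<in> ?V") auto
    qed
    then show "config_weight lam G (?f {v \<in> ?V. \<sigma> v = 1}) = config_weight lam G \<sigma>" by simp
  qed auto
  also have "\<dots> * empty_weight (map (edge_of G) es) =
     (\<Sum>T\<in>Pow ?V. config_weight lam G (?f T) * empty_weight (map (edge_of G) es))"
    by (rule sum_distrib_right)
  also have "\<dots> = part_sum lam ?V (map (edge_of G) es)"
    unfolding part_sum_def
  proof (intro sum.cong refl)
    fix T assume T: "T \<in> Pow ?V"
    have "(\<Prod>v\<in>?V. vertex_weight lam v (?f T)) = (\<Prod>v\<in>?V. if v \<in> T then lam else 1)"
      by (intro prod.cong) (auto simp: vertex_weight_def)
    also have "\<dots> = (\<Prod>v\<in>T. lam)"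
      using T V by (subst prod.inter_filter[symmetric]) (auto intro!: prod.cong arg_cong[where f = "\<lambda>A. lam ^ card A"])
    finally have v: "(\<Prod>v\<in>?V. vertex_weight lam v (?f T)) = lam ^ card T" by simp
    have "(\<Prod>e\<in>hedges G. edge_weight G e (?f T)) = prod_list (map (\<lambda>xs. edge_weight G (set xs) (?f T)) es)"
      using prod.distinct_set_conv_list[OF es(1), of "\<lambda>e. edge_weight G e (?f T)"] es(2)
      by (simp add: o_def)
    then have "(\<Prod>e\<in>hedges G. edge_weight G e (?f T)) * empty_weight (map (edge_of G) es)
      = prod_list (map (\<lambda>xs. edge_weight G (set xs) (?f T) * (if xs = [] then gamma_wt G (set xs) else 1)) es)"
      by (simp add: empty_weight_def o_def edge_of_def prod_list_map_mult)
    also have "\<dots> = prod_list (map (\<lambda>e. edge_wt e T) (map (edge_of G) es))"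
      unfolding map_map using T sub
      by (intro arg_cong[where f = prod_list] map_cong refl) (subst ew_edge_of, auto)
    finally show "config_weight lam G (?f T) * empty_weight (map (edge_of G) es) =
      lam ^ card T * prod_list (map (\<lambda>e. edge_wt e T) (map (edge_of G) es))"
      unfolding config_weight_def v by (simp add: mult_ac)
  qed
  finally show ?thesis by (simp add: V)
qed

lemma deg_listing:
  assumes "listing G vs es"
  shows "deg v (map (edge_of G) es) = vdegree G v"
proof -
  have es: "distinct (map set es)" "set ` set es = hedges G" using assms by (auto simp: listing_def)
  have "deg v (map (edge_of G) es) = length (filter (\<lambda>e. v \<in> e) (map set es))"
    by (simp add: deg_def edge_of_def filter_map o_def)
  also have "\<dots> = card (set (filter (\<lambda>e. v \<in> e) (map set es)))"
    using es by (intro distinct_card[symmetric]) (simp only: distinct_filter)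
  also have "\<dots> = vdegree G v" unfolding vdegree_def es(2)[symmetric] by (intro arg_cong[where f = card]) auto
  finally show ?thesis .
qed

lemma good_listing:
  assumes "listing G vs es" "valid_instance G" "max_degree G = D" "0 \<le> s"
    and "\<forall>e\<in>hedges G. 1 - s \<le> beta_wt G e \<and> beta_wt G e \<le> 1 \<and> 1 - s \<le> gamma_wt G e \<and> gamma_wt G e \<le> 1"
  shows "good s D (map (edge_of G) es)" "edges_in (set vs) (map (edge_of G) es)"
proof -
  have es: "set ` set es = hedges G" "\<forall>xs\<in>set es. distinct xs" "set vs = verts G"
    using assms by (auto simp: listing_def)
  have fin: "finite (verts G)" "hedges G \<subseteq> Pow (verts G)" using assms by (auto simp: valid_instance_def)
  have "vdegree G v \<le> D" for v
  proof (cases "v \<in> verts G")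
    case True
    then show ?thesis using fin unfolding assms(3)[symmetric] max_degree_def by (intro Max_ge) auto
  next
    case False
    then have "{e \<in> hedges G. v \<in> e} = {}" using fin by auto
    then show ?thesis unfolding vdegree_def by (metis card.empty le0)
  qed
  moreover have "edge_ok s (edge_of G xs)" if "xs \<in> set es" for xs
    using that es assms(5) by (auto simp: edge_ok_def edge_of_def)
  ultimately show "good s D (map (edge_of G) es)"
    by (auto simp: good_alt deg_listing[OF assms(1)])
  show "edges_in (set vs) (map (edge_of G) es)"
    using es fin unfolding edges_in_def edge_of_def by (auto simp flip: es(1))
qed

section \<open>Size of the input in terms of vertices and degree\<close>

lemma sum_degrees:
  "edges_in (set vs) E \<Longrightarrow> good s D E \<Longrightarrow> distinct vs \<Longrightarrow>
    sum_list (map (\<lambda>(b, g, S). length S) E) \<le> length vs * D"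
proof -
  assume a: "edges_in (set vs) E" "good s D E" "distinct vs"
  have "sum_list (map (\<lambda>(b, g, S). length S) E) = (\<Sum>v\<in>set vs. deg v E)"
    using a(1) a(2)[unfolded good_alt, THEN conjunct1]
  proof (induction E)
    case (Cons e E)
    obtain b g S where e: "e = (b, g, S)" by (cases e)
    have "length S = card (set S)" using Cons.prems by (simp add: e edge_ok_def distinct_card)
    also have "set S = {v \<in> set vs. v \<in> set S}" using Cons.prems by (auto simp: e)
    also have "card \<dots> = (\<Sum>v\<in>set vs. if v \<in> set S then 1 else 0)"
      by (simp add: sum.If_cases Collect_conj_eq)
    finally show ?case using Cons by (simp add: e sum.distrib)
  qed simp
  also have "\<dots> \<le> (\<Sum>v\<in>set vs. D)" using a(2) by (intro sum_mono) (simp add: good_alt)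
  finally show ?thesis using a(3) by (simp add: distinct_card)
qed

text \<open>Double counting of incidences bounds the nonempty hyperedges; the summand 1 is for the
  empty hyperedge, which no degree counts and which is listed at most once.\<close>

lemma length_listing:
  assumes l: "listing G vs es" and v: "valid_instance G" and D: "good s D (map (edge_of G) es)"
    "edges_in (set vs) (map (edge_of G) es)"
  shows "length es \<le> length vs * D + 1" "xs \<in> set es \<Longrightarrow> length xs \<le> length vs"
proof -
  have es: "distinct es" "\<And>xs ys. xs \<in> set es \<Longrightarrow> ys \<in> set es \<Longrightarrow> set xs = set ys \<Longrightarrow> xs = ys"
    using l by (auto simp: listing_def distinct_map inj_on_def)
  have "length es = length (filter (\<lambda>xs. xs = []) es) + length (filter (\<lambda>xs. xs \<noteq> []) es)"
    by (rule sum_length_filter_compl[symmetric])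
  also have "length (filter (\<lambda>xs. xs = []) es) \<le> 1"
  proof -
    have "card (set (filter (\<lambda>xs. xs = []) es)) \<le> card {[] :: nat list}" by (intro card_mono) auto
    then show ?thesis using es(1) by (simp add: distinct_card flip: distinct_card)
  qed
  also have "length (filter (\<lambda>xs. xs \<noteq> []) es) \<le> sum_list (map length es)"
  proof (induction es)
    case (Cons a es)
    have "a \<noteq> [] \<Longrightarrow> 1 \<le> length a" by (cases a) auto
    then show ?case using Cons by auto
  qed simp
  also have "sum_list (map length es) = sum_list (map (\<lambda>(b, g, S). length S) (map (edge_of G) es))"
    by (simp add: o_def edge_of_def)
  also have "\<dots> \<le> length vs * D" using D l by (intro sum_degrees) (auto simp: listing_def)
  finally show "length es \<le> length vs * D + 1" by simp
  assume xs: "xs \<in> set es"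
  have "length xs = card (set xs)" using l xs by (simp add: listing_def distinct_card)
  also have "\<dots> \<le> card (set vs)" using D(2) xs by (intro card_mono) (auto simp: edges_in_def edge_of_def)
  also have "\<dots> = length vs" using l by (intro distinct_card) (simp add: listing_def)
  finally show "length xs \<le> length vs" .
qed

section \<open>Running programs\<close>

text \<open>A weakest precondition calculus, so that the simplifier can execute programs symbolically; the
  predicate also receives the running time.\<close>

definition wp :: "program \<Rightarrow> val list \<Rightarrow> expr \<Rightarrow> (val \<Rightarrow> real \<Rightarrow> bool) \<Rightarrow> bool" where
  "wp P env a Q \<longleftrightarrow> (\<exists>v t. runs P env a v t \<and> Q v (real t))"

definition wps :: "program \<Rightarrow> val list \<Rightarrow> expr list \<Rightarrow> (val list \<Rightarrow> real \<Rightarrow> bool) \<Rightarrow> bool" where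
  "wps P env as Q \<longleftrightarrow> (\<exists>vs t. runs_list P env as vs t \<and> Q vs (real t))"

lemma wpI: "runs P env a v t \<Longrightarrow> Q v r \<Longrightarrow> r = real t \<Longrightarrow> wp P env a Q"
  by (auto simp: wp_def)

lemma wpE: "wp P env a Q \<Longrightarrow> (\<And>v t. runs P env a v t \<Longrightarrow> Q v (real t) \<Longrightarrow> thesis) \<Longrightarrow> thesis"
  by (auto simp: wp_def)

lemma wpsI: "runs_list P env as vs t \<Longrightarrow> Q vs r \<Longrightarrow> r = real t \<Longrightarrow> wps P env as Q"
  by (auto simp: wps_def)

lemma wpsE: "wps P env as Q \<Longrightarrow> (\<And>vs t. runs_list P env as vs t \<Longrightarrow> Q vs (real t) \<Longrightarrow> thesis) \<Longrightarrow> thesis"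
  by (auto simp: wps_def)

lemma wp_Var_I: "i < length env \<Longrightarrow> Q (env ! i) 1 \<Longrightarrow> wp P env (Var i) Q"
  by (rule wpI, rule runs_runs_list.Var) auto

lemma wp_IntC_I: "Q (VReal (of_int k)) 1 \<Longrightarrow> wp P env (IntC k) Q"
  by (rule wpI, rule runs_runs_list.IntC) auto

lemma wp_NilE_I: "Q VNil 1 \<Longrightarrow> wp P env NilE Q"
  by (rule wpI, rule runs_runs_list.NilE) auto

lemma wp_Arith_I: "wp P env a (\<lambda>u s. wp P env b (\<lambda>w t.
     \<exists>x y. u = VReal x \<and> w = VReal y \<and> (oper = Div \<longrightarrow> y \<noteq> 0) \<and> Q (VReal (arith oper x y)) (s + t + 1)))
   \<Longrightarrow> wp P env (Arith oper a b) Q"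
  by (elim wpE exE conjE, rule wpI, rule runs_runs_list.Arith, simp, simp) (auto simp: add_ac)

lemma wp_ConsE_I: "wp P env a (\<lambda>u s. wp P env b (\<lambda>w t. Q (VCons u w) (s + t + 1)))
   \<Longrightarrow> wp P env (ConsE a b) Q"
  by (elim wpE, rule wpI, rule runs_runs_list.ConsE) (auto simp: add_ac)

lemma wp_HeadE_I: "wp P env a (\<lambda>u s. \<exists>x y. u = VCons x y \<and> Q x (s + 1)) \<Longrightarrow> wp P env (HeadE a) Q"
  by (elim wpE exE conjE, rule wpI, rule runs_runs_list.HeadE) (auto simp: add_ac)

lemma wp_TailE_I: "wp P env a (\<lambda>u s. \<exists>x y. u = VCons x y \<and> Q y (s + 1)) \<Longrightarrow> wp P env (TailE a) Q"
  by (elim wpE exE conjE, rule wpI, rule runs_runs_list.TailE) (auto simp: add_ac)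

lemma wp_LetE_I: "wp P env a (\<lambda>u s. wp P (u # env) b (\<lambda>w t. Q w (s + t + 1))) \<Longrightarrow> wp P env (LetE a b) Q"
  by (elim wpE, rule wpI, rule runs_runs_list.LetE) (auto simp: add_ac)

lemma wp_IfNil_I: "wp P env a (\<lambda>u s. if u = VNil then wp P env c (\<lambda>v r. Q v (s + r + 1))
     else wp P env d (\<lambda>v r. Q v (s + r + 1)))
   \<Longrightarrow> wp P env (IfNil a c d) Q"
  by (erule wpE, simp split: if_splits; erule wpE, rule wpI,
      (rule runs_runs_list.IfNil_True, assumption, assumption | rule runs_runs_list.IfNil_False, assumption, assumption, assumption), assumption) auto

lemma wp_IfLess_I: "wp P env a (\<lambda>u s. wp P env b (\<lambda>w t.
     \<exists>x y. u = VReal x \<and> w = VReal y \<and> (if x < y then wp P env c (\<lambda>v r. Q v (s + t + r + 1))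
     else wp P env d (\<lambda>v r. Q v (s + t + r + 1)))))
   \<Longrightarrow> wp P env (IfLess a b c d) Q"
proof (elim wpE exE conjE, goal_cases)
  case (1 u s w t x y)
  show ?case
  proof (cases "x < y")
    case True
    then show ?thesis using 1
      by (simp, elim wpE) (rule wpI, rule runs_runs_list.IfLess_True, auto simp: add_ac)
  next
    case False
    then show ?thesis using 1
      by (simp, elim wpE) (rule wpI, rule runs_runs_list.IfLess_False, auto simp: add_ac)
  qed
qed

lemma wp_Call_I: "wps P env as (\<lambda>us s. f < length P \<and> wp P us (P ! f) (\<lambda>v t. Q v (s + t + 1)))
   \<Longrightarrow> wp P env (Call f as) Q"
  by (elim wpsE conjE wpE, rule wpI, rule runs_runs_list.Call) (auto simp: add_ac)

lemma wps_Nil_I: "Q [] 0 \<Longrightarrow> wps P env [] Q"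
  by (rule wpsI, rule runs_runs_list.Nil) auto

lemma wps_Cons_I: "wp P env a (\<lambda>u s. wps P env as (\<lambda>us t. Q (u # us) (s + t))) \<Longrightarrow> wps P env (a # as) Q"
  by (elim wpE wpsE, rule wpsI, rule runs_runs_list.Cons) auto

lemma wpI': "runs P env a v t \<Longrightarrow> Q v (real t) \<Longrightarrow> wp P env a Q"
  by (auto simp: wp_def)

lemma wpsI': "runs_list P env as vs t \<Longrightarrow> Q vs (real t) \<Longrightarrow> wps P env as Q"
  by (auto simp: wps_def)

lemma wp_Var: "wp P env (Var i) Q \<longleftrightarrow> i < length env \<and> Q (env ! i) 1"
  by (rule iffI, erule wpE, erule runs_VarE, simp, simp add: wp_Var_I)

lemma wp_IntC: "wp P env (IntC k) Q \<longleftrightarrow> Q (VReal (of_int k)) 1"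
  by (rule iffI, erule wpE, erule runs_IntCE, simp, simp add: wp_IntC_I)

lemma wp_NilE: "wp P env NilE Q \<longleftrightarrow> Q VNil 1"
  by (rule iffI, erule wpE, erule runs_NilEE, simp, simp add: wp_NilE_I)

text \<open>Continuations take the place of the existential quantifiers in the introduction rules:
  once the value is known, they vanish by computation.\<close>

fun on_real :: "val \<Rightarrow> (real \<Rightarrow> bool) \<Rightarrow> bool" where
  "on_real (VReal x) K = K x"
| "on_real _ K = False"

fun on_cons :: "val \<Rightarrow> (val \<Rightarrow> val \<Rightarrow> bool) \<Rightarrow> bool" where
  "on_cons (VCons x y) K = K x y"
| "on_cons _ K = False"

lemma on_real_iff: "on_real u K \<longleftrightarrow> (\<exists>x. u = VReal x \<and> K x)"
  by (cases u) auto

lemma on_cons_iff: "on_cons u K \<longleftrightarrow> (\<exists>x y. u = VCons x y \<and> K x y)"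
  by (cases u) auto

lemma wp_Arith: "wp P env (Arith oper a b) Q \<longleftrightarrow> wp P env a (\<lambda>u s. wp P env b (\<lambda>w t.
     on_real u (\<lambda>x. on_real w (\<lambda>y. (oper = Div \<longrightarrow> y \<noteq> 0) \<and> Q (VReal (arith oper x y)) (s + t + 1)))))"
  by (rule iffI, erule wpE, erule runs_ArithE, (rule wpI', assumption)+, simp add: add_ac,
    rule wp_Arith_I, simp add: on_real_iff)

lemma wp_ConsE: "wp P env (ConsE a b) Q \<longleftrightarrow> wp P env a (\<lambda>u s. wp P env b (\<lambda>w t. Q (VCons u w) (s + t + 1)))"
  by (rule iffI, erule wpE, erule runs_ConsEE, (rule wpI', assumption)+, simp add: add_ac, erule wp_ConsE_I)

lemma wp_HeadE: "wp P env (HeadE a) Q \<longleftrightarrow> wp P env a (\<lambda>u s. on_cons u (\<lambda>x y. Q x (s + 1)))"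
  by (rule iffI, erule wpE, erule runs_HeadEE, (rule wpI', assumption)+, simp add: add_ac,
    rule wp_HeadE_I, simp add: on_cons_iff)

lemma wp_TailE: "wp P env (TailE a) Q \<longleftrightarrow> wp P env a (\<lambda>u s. on_cons u (\<lambda>x y. Q y (s + 1)))"
  by (rule iffI, erule wpE, erule runs_TailEE, (rule wpI', assumption)+, simp add: add_ac,
    rule wp_TailE_I, simp add: on_cons_iff)

lemma wp_LetE: "wp P env (LetE a b) Q \<longleftrightarrow> wp P env a (\<lambda>u s. wp P (u # env) b (\<lambda>w t. Q w (s + t + 1)))"
  by (rule iffI, erule wpE, erule runs_LetEE, (rule wpI', assumption)+, simp add: add_ac, erule wp_LetE_I)

lemma wp_IfNil: "wp P env (IfNil a c d) Q \<longleftrightarrow> wp P env a (\<lambda>u s.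
     if u = VNil then wp P env c (\<lambda>v r. Q v (s + r + 1)) else wp P env d (\<lambda>v r. Q v (s + r + 1)))"
  by (rule iffI, erule wpE, erule runs_IfNilE;
      ((rule wpI', assumption, simp, rule wpI', assumption, simp add: add_ac) | erule wp_IfNil_I)?)

lemma wp_IfLess: "wp P env (IfLess a b c d) Q \<longleftrightarrow> wp P env a (\<lambda>u s. wp P env b (\<lambda>w t.
     on_real u (\<lambda>x. on_real w (\<lambda>y. if x < y then wp P env c (\<lambda>v r. Q v (s + t + r + 1))
     else wp P env d (\<lambda>v r. Q v (s + t + r + 1))))))"
  by (rule iffI, erule wpE, erule runs_IfLessE;
      ((rule wpI', assumption, rule wpI', assumption, simp, rule wpI', assumption, simp add: add_ac)
       | (rule wp_IfLess_I, simp add: on_real_iff))?)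

lemma wp_Call: "wp P env (Call f as) Q \<longleftrightarrow>
   wps P env as (\<lambda>us s. f < length P \<and> wp P us (P ! f) (\<lambda>v t. Q v (s + t + 1)))"
  by (rule iffI, erule wpE, erule runs_CallE, rule wpsI', assumption, rule conjI, assumption,
    rule wpI', assumption, simp add: add_ac, erule wp_Call_I)

lemma wps_Nil: "wps P env [] Q \<longleftrightarrow> Q [] 0"
  by (rule iffI, erule wpsE, erule runs_list_NilE, simp, simp add: wps_Nil_I)

lemma wps_Cons: "wps P env (a # as) Q \<longleftrightarrow> wp P env a (\<lambda>u s. wps P env as (\<lambda>us t. Q (u # us) (s + t)))"
  by (rule iffI, erule wpsE, erule runs_list_ConsE, rule wpI', assumption, rule wpsI', assumption, simp add: add_ac,
    erule wps_Cons_I)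

lemmas wp_simps = wp_Var wp_IntC wp_NilE wp_Arith wp_ConsE wp_HeadE wp_TailE wp_LetE wp_IfNil wp_IfLess
  wp_Call wps_Nil wps_Cons

lemma wp_mono: "wp P env a (\<lambda>v t. v = w \<and> t \<le> T) \<Longrightarrow> (\<And>t. t \<le> T \<Longrightarrow> Q w t) \<Longrightarrow> wp P env a Q"
  by (auto simp: wp_def)

section \<open>The program\<close>

text \<open>Functions are called by their position in \<open>prog\<close>. Their arguments are, in this order:
  \<open>search\<close>: vertices, edges, \<open>lam\<close>, \<open>\<epsilon>\<close>, budget; \<open>zval\<close>: vertices, edges, \<open>lam\<close>, budget, direction;
  \<open>marg\<close>: edges, vertex, \<open>lam\<close>, budget, direction; \<open>sweep\<close>: processed edges, remaining edges, vertex,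
  \<open>lam\<close>, budget, direction, accumulator; \<open>block\<close>: edges, vertices, spin, \<open>lam\<close>, budget, direction.
  The direction is \<open>1\<close> for upper bounds and \<open>- 1\<close> for lower bounds.\<close>

definition f_main :: expr where
  "f_main = Call 1 [HeadE (Var 0), TailE (Var 0), Var 1, Var 2, IntC 1]"

definition f_search :: expr where
  "f_search =
    LetE (Call 2 [Var 0, Var 1, Var 2, Var 4, IntC (- 1)])
   (LetE (Call 2 [Var 1, Var 2, Var 3, Var 5, IntC 1])
   (IfLess (Var 0) (Arith Mul (Var 1) (Arith Add (IntC 1) (Var 5)))
      (Var 1)
      (Call 1 [Var 2, Var 3, Var 4, Var 5, Arith Mul (IntC 2) (Var 6)])))"

definition f_zval :: expr where
  "f_zval = IfNil (Var 0) (Call 3 [Var 1])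
    (Arith Mul (Arith Add (IntC 1) (Call 4 [Var 1, HeadE (Var 0), Var 2, Var 3, Var 4]))
      (Call 2 [TailE (Var 0), Call 8 [HeadE (Var 0), IntC 0, Var 1], Var 2, Var 3, Var 4]))"

definition f_prodb :: expr where
  "f_prodb = IfNil (Var 0) (IntC 1) (Arith Mul (HeadE (HeadE (Var 0))) (Call 3 [TailE (Var 0)]))"

definition f_marg :: expr where
  "f_marg = LetE (Call 7 [Var 0, Var 1])
    (IfLess (Var 4) (IntC 1)
      (IfLess (Var 5) (IntC 0) (Arith Div (Var 3) (Var 0)) (Arith Mul (Var 3) (Var 0)))
      (Call 5 [NilE, Var 1, Var 2, Var 3, Arith Div (Var 4) (Arith Mul (IntC 4) (Var 0)), Var 5, Var 3]))"

definition f_sweep :: expr where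
  "f_sweep = IfNil (Var 1) (Var 6)
    (LetE (Call 9 [Var 2, IntC 1, HeadE (Var 1)])
    (IfLess (IntC 0) (Call 10 [Var 3, TailE (TailE (HeadE (Var 2)))])
      (LetE (Call 11 [Var 1, Call 8 [Var 3, IntC 0, TailE (Var 2)]])
      (LetE (Arith Div (Var 6) (Call 13 [TailE (TailE (HeadE (Var 3)))]))
        (Call 5 [ConsE (Var 2) (Var 3), TailE (Var 4), Var 5, Var 6, Var 7, Var 8,
          Arith Mul (Var 9) (Arith Div
            (Arith Sub (IntC 1) (Arith Mul (Arith Sub (IntC 1) (HeadE (TailE (HeadE (Var 4)))))
              (Call 6 [Var 1, TailE (TailE (Var 2)), IntC 1, Var 6, Var 0, Arith Sub (IntC 0) (Var 8)])))
            (Arith Sub (IntC 1) (Arith Mul (Arith Sub (IntC 1) (HeadE (HeadE (Var 4))))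
              (Call 6 [Var 1, TailE (TailE (Var 2)), IntC 0, Var 6, Var 0, Arith Sub (IntC 0) (Var 8)]))))])))
      (Call 5 [ConsE (Var 0) (Var 1), TailE (Var 2), Var 3, Var 4, Var 5, Var 6, Var 7])))"

definition f_block :: expr where
  "f_block = IfNil (Var 1) (IntC 1)
    (LetE (Call 4 [Var 0, HeadE (Var 1), Var 3, Var 4, Var 5])
    (Arith Mul
      (IfLess (IntC 0) (Var 3) (Arith Div (Var 0) (Arith Add (IntC 1) (Var 0)))
        (Arith Div (IntC 1) (Arith Add (IntC 1) (Var 0))))
      (Call 6 [Call 8 [HeadE (Var 2), Var 3, Var 1], TailE (Var 2), Var 3, Var 4, Var 5, Var 6])))"

definition f_pow3 :: expr where
  "f_pow3 = IfNil (Var 0) (IntC 1)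
    (Arith Mul (IfLess (IntC 0) (Call 10 [Var 1, TailE (TailE (HeadE (Var 0)))]) (IntC 3) (IntC 1))
      (Call 7 [TailE (Var 0), Var 1]))"

definition f_pin :: expr where
  "f_pin = IfNil (Var 2) NilE
    (ConsE (Call 9 [Var 0, Var 1, HeadE (Var 2)]) (Call 8 [Var 0, Var 1, TailE (Var 2)]))"

definition f_pin_edge :: expr where
  "f_pin_edge = IfLess (IntC 0) (Call 10 [Var 0, TailE (TailE (Var 2))])
    (IfLess (IntC 0) (Var 1)
      (ConsE (IntC 1) (ConsE (HeadE (TailE (Var 2))) (Call 12 [Var 0, TailE (TailE (Var 2))])))
      (ConsE (HeadE (Var 2)) (ConsE (IntC 1) (Call 12 [Var 0, TailE (TailE (Var 2))]))))
    (Var 2)"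

definition f_mem :: expr where
  "f_mem = IfNil (Var 1) (IntC 0)
    (IfLess (Var 0) (HeadE (Var 1)) (Call 10 [Var 0, TailE (Var 1)])
      (IfLess (HeadE (Var 1)) (Var 0) (Call 10 [Var 0, TailE (Var 1)]) (IntC 1)))"

definition f_revapp :: expr where
  "f_revapp = IfNil (Var 0) (Var 1) (Call 11 [TailE (Var 0), ConsE (HeadE (Var 0)) (Var 1)])"

definition f_rem :: expr where
  "f_rem = IfNil (Var 1) NilE
    (IfLess (Var 0) (HeadE (Var 1)) (ConsE (HeadE (Var 1)) (Call 12 [Var 0, TailE (Var 1)]))
      (IfLess (HeadE (Var 1)) (Var 0) (ConsE (HeadE (Var 1)) (Call 12 [Var 0, TailE (Var 1)]))
        (Call 12 [Var 0, TailE (Var 1)])))"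

definition f_len :: expr where
  "f_len = IfNil (Var 0) (IntC 0) (Arith Add (IntC 1) (Call 13 [TailE (Var 0)]))"

definition prog :: program where
  "prog = [f_main, f_search, f_zval, f_prodb, f_marg, f_sweep, f_block, f_pow3, f_pin, f_pin_edge,
     f_mem, f_revapp, f_rem, f_len]"

lemma length_prog [simp]: "length prog = 14" by (simp add: prog_def)

lemma prog_nth [simp]:
  "prog ! 0 = f_main" "prog ! Suc 0 = f_search" "prog ! 2 = f_zval" "prog ! 3 = f_prodb" "prog ! 4 = f_marg"
  "prog ! 5 = f_sweep" "prog ! 6 = f_block" "prog ! 7 = f_pow3" "prog ! 8 = f_pin" "prog ! 9 = f_pin_edge"
  "prog ! 10 = f_mem" "prog ! 11 = f_revapp" "prog ! 12 = f_rem" "prog ! 13 = f_len"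
  by (simp_all add: prog_def)

section \<open>Encodings and the list routines\<close>

definition yields :: "expr \<Rightarrow> val list \<Rightarrow> val \<Rightarrow> real \<Rightarrow> bool" where
  "yields body env w T \<longleftrightarrow> wp prog env body (\<lambda>v t. v = w \<and> t \<le> T)"

text \<open>Used at every call: symbolic execution stops at the body of the callee, and its known
  result and time bound are put in its place.\<close>

lemma wp_yields: "yields body env w T \<Longrightarrow> (\<And>t. t \<le> T \<Longrightarrow> Q w t) \<Longrightarrow> wp prog env body Q"
  unfolding yields_def by (rule wp_mono)

definition edge_enc :: "edge \<Rightarrow> val" where
  "edge_enc = (\<lambda>(b, g, S). VCons (VReal b) (VCons (VReal g) (vertices_val S)))"

definition edges_enc :: "edge list \<Rightarrow> val" where
  "edges_enc E = list_val (map edge_enc E)"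

lemma vertices_val_simps [simp]:
  "vertices_val [] = VNil" "vertices_val (v # vs) = VCons (VReal (real v)) (vertices_val vs)"
  by (simp_all add: vertices_val_def)

lemma edges_enc_simps [simp]:
  "edges_enc [] = VNil" "edges_enc (e # E) = VCons (edge_enc e) (edges_enc E)"
  by (simp_all add: edges_enc_def)

definition flag :: "bool \<Rightarrow> real" where
  "flag t = (if t then 1 else 0)"

lemma flag_simps [simp]: "flag True = 1" "flag False = 0" "0 < flag t \<longleftrightarrow> t"
  by (auto simp: flag_def)

definition direction :: "bool \<Rightarrow> real" where
  "direction up = (if up then 1 else - 1)"

lemma direction_simps [simp]:
  "direction True = 1" "direction False = - 1" "direction up < 0 \<longleftrightarrow> \<not> up" "- direction up = direction (\<not> up)"
  by (auto simp: direction_def)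

text \<open>Equality of vertices is decided by two strict comparisons of reals, hence the three
  cases.\<close>

lemma yields_mem:
  "yields f_mem [VReal (real v), vertices_val S] (VReal (flag (v \<in> set S))) (20 * (real (length S) + 1))"
proof (induction S)
  case Nil
  show ?case by (simp add: yields_def f_mem_def wp_simps)
next
  case (Cons u S)
  consider "v < u" | "u < v" | "v = u" by linarith
  then show ?case
  proof cases
    case 1
    show ?thesis unfolding yields_def using 1
      by (subst f_mem_def, simp add: wp_simps) (rule wp_yields[OF Cons], simp)
  next
    case 2
    show ?thesis unfolding yields_def using 2
      by (subst f_mem_def, simp add: wp_simps) (rule wp_yields[OF Cons], simp)
  next
    case 3
    show ?thesis unfolding yields_def using 3 by (subst f_mem_def, simp add: wp_simps)
  qed
qed

lemma yields_rem:
  "yields f_rem [VReal (real v), vertices_val S] (vertices_val (removeAll v S)) (20 * (real (length S) + 1))"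
proof (induction S)
  case Nil
  show ?case by (simp add: yields_def f_rem_def wp_simps)
next
  case (Cons u S)
  consider "v < u" | "u < v" | "v = u" by linarith
  then show ?case
  proof cases
    case 1
    show ?thesis unfolding yields_def using 1
      by (subst f_rem_def, simp add: wp_simps) (rule wp_yields[OF Cons], simp)
  next
    case 2
    show ?thesis unfolding yields_def using 2
      by (subst f_rem_def, simp add: wp_simps) (rule wp_yields[OF Cons], simp)
  next
    case 3
    show ?thesis unfolding yields_def 3
      by (subst f_rem_def, simp add: wp_simps, rule wp_yields[OF Cons[unfolded 3]], simp)
  qed
qed

lemma yields_len: "yields f_len [vertices_val S] (VReal (real (length S))) (20 * (real (length S) + 1))"
proof (induction S)
  case Nil
  show ?case by (simp add: yields_def f_len_def wp_simps)
next
  case (Cons u S)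
  show ?case unfolding yields_def
    by (subst f_len_def, simp add: wp_simps, rule wp_yields[OF Cons], simp)
qed

lemma yields_revapp:
  "yields f_revapp [edges_enc E, edges_enc F] (edges_enc (rev E @ F)) (20 * (real (length E) + 1))"
proof (induction E arbitrary: F)
  case Nil
  show ?case by (simp add: yields_def f_revapp_def wp_simps)
next
  case (Cons e E)
  show ?case unfolding yields_def
    by (subst f_revapp_def, simp add: wp_simps, rule wp_yields[OF Cons[of "e # F", simplified]], simp)
qed

lemma yields_prodb: "yields f_prodb [edges_enc E] (VReal (prod_list (map fst E))) (20 * (real (length E) + 1))"
proof (induction E)
  case Nil
  show ?case by (simp add: yields_def f_prodb_def wp_simps)
next
  case (Cons e E)
  obtain b g S where e: "e = (b, g, S)" by (cases e)
  show ?case unfolding yields_def e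
    by (subst f_prodb_def, simp add: wp_simps edge_enc_def, rule wp_yields[OF Cons], simp)
qed

text \<open>A single number bounds both the number of hyperedges and their sizes. Pinning increases
  neither, so the same \<open>N\<close> serves the whole recursion.\<close>

definition small :: "nat \<Rightarrow> edge list \<Rightarrow> bool" where
  "small N E \<longleftrightarrow> length E \<le> N \<and> (\<forall>(b, g, S)\<in>set E. length S \<le> N)"

lemma yields_pin_edge:
  "yields f_pin_edge [VReal (real v), VReal (flag t), edge_enc (b, g, S)] (edge_enc (pin_edge v t (b, g, S)))
     (70 * (real (length S) + 1))"
proof (cases "v \<in> set S")
  case True
  show ?thesis
    unfolding yields_def f_pin_edge_def
    apply (simp add: wp_simps edge_enc_def)
    apply (rule wp_yields[OF yields_mem])
    using True apply (cases t)
     apply (simp_all add: wp_simps pin_edge_def)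
     apply (rule wp_yields[OF yields_rem], simp)+
    done
next
  case False
  show ?thesis
    unfolding yields_def f_pin_edge_def
    by (simp add: wp_simps edge_enc_def, rule wp_yields[OF yields_mem], insert False,
      simp add: wp_simps pin_edge_def edge_enc_def)
qed

lemma yields_pin:
  assumes "\<And>b g S. (b, g, S) \<in> set E \<Longrightarrow> length S \<le> N"
  shows "yields f_pin [VReal (real v), VReal (flag t), edges_enc E] (edges_enc (pin v t E))
     (90 * (real N + 1) * (real (length E) + 1))"
  using assms
proof (induction E)
  case Nil
  show ?case by (simp add: yields_def f_pin_def wp_simps)
next
  case (Cons e E)
  obtain b g S where e: "e = (b, g, S)" by (cases e)
  have IH: "yields f_pin [VReal (real v), VReal (flag t), edges_enc E] (edges_enc (pin v t E))
     (90 * (real N + 1) * (real (length E) + 1))"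
    using Cons.prems by (intro Cons.IH) (meson list.set_intros(2))
  have l: "length S \<le> N" using Cons.prems[of b g S] by (simp add: e)
  show ?case unfolding yields_def e
    apply (subst f_pin_def, simp add: wp_simps)
    apply (rule wp_yields[OF yields_pin_edge], simp add: wp_simps)
    apply (rule wp_yields[OF IH])
    using l by (simp add: algebra_simps)
qed

lemma yields_pow3:
  assumes "\<And>b g S. (b, g, S) \<in> set E \<Longrightarrow> length S \<le> N"
  shows "yields f_pow3 [edges_enc E, VReal (real v)] (VReal (3 ^ deg v E))
     (40 * (real N + 1) * (real (length E) + 1))"
  using assms
proof (induction E)
  case Nil
  show ?case by (simp add: yields_def f_pow3_def wp_simps)
next
  case (Cons e E)
  obtain b g S where e: "e = (b, g, S)" by (cases e)
  have IH: "yields f_pow3 [edges_enc E, VReal (real v)] (VReal (3 ^ deg v E))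
     (40 * (real N + 1) * (real (length E) + 1))"
    using Cons.prems by (intro Cons.IH) (meson list.set_intros(2))
  have l: "length S \<le> N" using Cons.prems[of b g S] by (simp add: e)
  show ?case unfolding yields_def e
    apply (subst f_pow3_def, simp add: wp_simps edge_enc_def)
    apply (cases "v \<in> set S"; simp add: wp_simps; rule wp_yields[OF yields_mem], simp add: wp_simps;
        rule wp_yields[OF IH])
    using l by (simp_all add: algebra_simps)
qed

lemma wp_yields':
  "yields body env' w T \<Longrightarrow> env = env' \<Longrightarrow> (\<And>t. t \<le> T \<Longrightarrow> Q w t) \<Longrightarrow> wp prog env body Q"
  using wp_yields by simp

lemma yields_le: "yields body env w T \<Longrightarrow> T \<le> T' \<Longrightarrow> yields body env w T'"
  unfolding yields_def by (erule wp_mono) simp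

lemma on_cons_edge [simp]: "on_cons (edge_enc (b, g, S)) K = K (VReal b) (VCons (VReal g) (vertices_val S))"
  by (simp add: edge_enc_def)

lemma small_pin: "small N E \<Longrightarrow> small N (pin v t E)"
proof -
  have "length (removeAll v S) \<le> N" if "length S \<le> N" for S
    using that length_filter_le[of "\<lambda>x. v \<noteq> x" S] unfolding removeAll_filter_not_eq by linarith
  then show "small N E \<Longrightarrow> small N (pin v t E)"
    by (fastforce simp: small_def pin_edge_def split: if_splits)
qed

lemma small_append [simp]: "small N (E @ F) \<longleftrightarrow> length E + length F \<le> N \<and> small N E \<and> small N F"
  unfolding small_def set_append ball_Un length_append by linarith

lemma small_rev [simp]: "small N (rev E) = small N E"
  by (simp add: small_def)

lemma small_Cons_iff [simp]:
  "small N (e # E) \<longleftrightarrow> Suc (length E) \<le> N \<and> length (snd (snd e)) \<le> N \<and> small N E"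
  by (auto simp: small_def split: prod.split)

lemma length_pin_edge: "length (snd (snd (pin_edge v t e))) \<le> length (snd (snd e))"
  by (auto simp: pin_edge_def removeAll_filter_not_eq split: prod.split)

lemma yields_pin_small:
  assumes "small N E"
  shows "yields f_pin [VReal (real v), VReal (flag t), edges_enc E] (edges_enc (pin v t E)) (90 * (real N + 1)\<^sup>2)"
proof (rule yields_le[OF yields_pin])
  show "\<And>b g S. (b, g, S) \<in> set E \<Longrightarrow> length S \<le> N" using assms by (auto simp: small_def)
  have "(real N + 1) * (real (length E) + 1) \<le> (real N + 1) * (real N + 1)"
    using assms by (intro mult_left_mono) (auto simp: small_def)
  then show "90 * (real N + 1) * (real (length E) + 1) \<le> 90 * (real N + 1)\<^sup>2"
    unfolding power2_eq_square by linarith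
qed

lemma yields_pow3_small:
  assumes "small N E"
  shows "yields f_pow3 [edges_enc E, VReal (real v)] (VReal (3 ^ deg v E)) (40 * (real N + 1)\<^sup>2)"
proof (rule yields_le[OF yields_pow3])
  show "\<And>b g S. (b, g, S) \<in> set E \<Longrightarrow> length S \<le> N" using assms by (auto simp: small_def)
  have "(real N + 1) * (real (length E) + 1) \<le> (real N + 1) * (real N + 1)"
    using assms by (intro mult_left_mono) (auto simp: small_def)
  then show "40 * (real N + 1) * (real (length E) + 1) \<le> 40 * (real N + 1)\<^sup>2"
    unfolding power2_eq_square by linarith
qed

section \<open>Running time of the recursion, affine in the budget\<close>

definition marg_runs :: "real \<Rightarrow> real \<Rightarrow> nat \<Rightarrow> real \<Rightarrow> nat \<Rightarrow> approx \<Rightarrow> real \<Rightarrow> real \<Rightarrow> bool" where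
  "marg_runs lam s D X N m K L \<longleftrightarrow> (\<forall>V A u B up. finite V \<longrightarrow> u \<in> V \<longrightarrow> edges_in V A \<longrightarrow>
     good s D A \<longrightarrow> small N A \<longrightarrow> 0 < B \<longrightarrow> B < X \<longrightarrow>
     yields f_marg [edges_enc A, VReal (real u), VReal lam, VReal B, VReal (direction up)]
       (VReal (m A u B up)) (K + L * B))"

context approximation begin

lemma yields_block:
  assumes run: "marg_runs lam s D X N m K L" and KL: "0 \<le> K" "0 \<le> L"
    and "finite V" "set S \<subseteq> V" "distinct S" "edges_in V A" "good s D A" "small N A"
    and B: "0 < B" "B < X"
  shows "yields f_block [edges_enc A, vertices_val S, VReal (flag t), VReal lam, VReal B, VReal (direction up)]
    (VReal (block m t B up A S)) ((real (length S) + 1) * (K + L * B + 150 * (real N + 1)\<^sup>2))"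
  using assms(4-9)
proof (induction S arbitrary: V A)
  case Nil
  have "3 \<le> K + L * B + 150 * (real N + 1)\<^sup>2"
    using one_le_power[of "real N + 1" 2] KL B by (smt (verit) mult_nonneg_nonneg of_nat_0_le_iff)
  then show ?case by (simp add: yields_def f_block_def wp_simps block_def)
next
  case (Cons u us)
  define W where "W = K + L * B + 150 * (real N + 1)\<^sup>2"
  define T where "T = (real (length us) + 1) * W"
  have IH: "yields f_block [edges_enc (pin u t A), vertices_val us, VReal (flag t), VReal lam, VReal B, VReal (direction up)]
    (VReal (block m t B up (pin u t A) us)) T"
    unfolding W_def T_def using Cons.prems s
    by (intro Cons.IH[of "V - {u}"]) (auto intro: edges_in_pin good_pin small_pin)
  have mr: "yields f_marg [edges_enc A, VReal (real u), VReal lam, VReal B, VReal (direction up)]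
       (VReal (m A u B up)) (K + L * B)"
    using run Cons.prems B unfolding marg_runs_def by auto
  have r: "0 < m A u B up" using m_props(3)[of V u A B up] Cons.prems B by auto
  have one: "1 \<le> (real N + 1)\<^sup>2" by (rule one_le_power) simp
  have TT: "(real (length (u # us)) + 1) * W = T + W" by (simp add: T_def algebra_simps)
  have bl: "block m t B up A (u # us) = spin_prob t (m A u B up) * block m t B up (pin u t A) us"
    by (simp add: block_def)
  have r1: "1 + m A u B up \<noteq> 0" using r by linarith
  define res where "res = block m t B up A (u # us)"
  define Tn where "Tn = T + W"
  note pn = yields_pin_small[OF Cons.prems(6), of u]
  have Tn: "T + K + L * B + 90 * (real N + 1)\<^sup>2 + 50 \<le> Tn" using one unfolding Tn_def W_def by linarith
  show ?case unfolding W_def[symmetric] TT unfolding res_def[symmetric] Tn_def[symmetric] yields_def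
  proof (cases t)
    case True
    then have True': "t = True" by simp
    show "wp prog [edges_enc A, vertices_val (u # us), VReal (flag t), VReal lam, VReal B, VReal (direction up)] f_block
       (\<lambda>v t. v = VReal res \<and> t \<le> Tn)"
      apply (subst f_block_def, simp add: wp_simps True')
      apply (rule wp_yields[OF mr], (simp add: wp_simps r1)?)
      apply (rule wp_yields[OF pn[of True, unfolded flag_simps]], (simp add: wp_simps)?)
      apply (rule wp_yields[OF IH[unfolded True' flag_simps]])
      using Tn unfolding res_def bl[unfolded True'] True' spin_prob_def by simp
  next
    case False
    then have False': "t = False" by simp
    show "wp prog [edges_enc A, vertices_val (u # us), VReal (flag t), VReal lam, VReal B, VReal (direction up)] f_block
       (\<lambda>v t. v = VReal res \<and> t \<le> Tn)"
      apply (subst f_block_def, simp add: wp_simps False')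
      apply (rule wp_yields[OF mr], (simp add: wp_simps r1)?)
      apply (rule wp_yields[OF pn[of False, unfolded flag_simps]], (simp add: wp_simps)?)
      apply (rule wp_yields[OF IH[unfolded False' flag_simps]])
      using Tn unfolding res_def bl[unfolded False'] False' spin_prob_def by simp
  qed
qed

text \<open>Accuracy enters the running time because a division by zero has no result: the
  denominator \<open>1 - (1 - b) * Q\<close> is nonzero since the computed \<open>Q\<close> lies
  between 0 and 1.\<close>

lemma yields_sweep:
  assumes run: "marg_runs lam s D X N m K L" and KL: "0 \<le> K" "0 \<le> L"
    and "finite V" "v \<notin> V" "edges_in V dn" "edges_in (insert v V) es" "good s D (rev dn @ es)"
    and "small N (rev dn @ es)" and B: "0 < B" "B < X"
  shows "yields f_sweep [edges_enc dn, edges_enc es, VReal (real v), VReal lam, VReal B, VReal (direction up), VReal acc]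
    (VReal (sweep m v B up dn es acc))
    (10 + real (length es) * (400 * (real N + 1)\<^sup>2) +
      real (deg v es) * (2 * (real N * (K + 150 * (real N + 1)\<^sup>2) + L * B)))"
  using assms(4-9)
proof (induction es arbitrary: dn acc)
  case Nil
  show ?case by (simp add: yields_def f_sweep_def wp_simps)
next
  case (Cons e es)
  obtain b g S where e: "e = (b, g, S)" by (cases e)
  define e1 where "e1 = pin_edge v True (b, g, S)"
  have ok: "edge_ok s (b, g, S)" using Cons.prems by (simp add: good_alt e)
  then have dS: "distinct S" by (simp add: edge_ok_def)
  have good: "good s D (rev dn @ pin v False es)" "good s D (rev (e1 # dn) @ es)"
    unfolding e1_def by (rule good_step[OF Cons.prems(5)[unfolded e] s(1)])+
  have in1: "edges_in V (e1 # dn)" using Cons.prems by (auto simp: e1_def e)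
  have in2: "edges_in (insert v V) es" using Cons.prems by auto
  have sm1: "small N (rev (e1 # dn) @ es)"
    using Cons.prems(6) length_pin_edge[of v True e] unfolding e1_def e by auto
  have sm2: "small N (rev dn @ pin v False es)" "small N es" "length S \<le> N" "length dn \<le> N"
    using Cons.prems(6) small_pin[of N es v False] by (auto simp: e)
  define M where "M = real N + 1"
  define W where "W = 2 * (real N * (K + 150 * (real N + 1)\<^sup>2) + L * B)"
  define T where "T = 10 + real (length es) * (400 * (real N + 1)\<^sup>2) + real (deg v es) * W"
  have IH: "yields f_sweep [VCons (edge_enc e1) (edges_enc dn), edges_enc es, VReal (real v), VReal lam, VReal B, VReal (direction up), VReal acc']
    (VReal (sweep m v B up (e1 # dn) es acc')) T" for acc'
    unfolding T_def W_def using Cons.IH[OF Cons.prems(1,2) in1 in2 good(2) sm1, of acc'] by simp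
  have MM: "1 \<le> M" "M \<le> M\<^sup>2" by (auto simp: M_def power2_eq_square)
  have pe: "yields f_pin_edge [VReal (real v), VReal 1, edge_enc (b, g, S)] (edge_enc e1) (70 * M)"
    using yields_pin_edge[of v True b g S] sm2 unfolding e1_def by (auto elim!: yields_le simp: M_def)
  have me: "yields f_mem [VReal (real v), vertices_val S] (VReal (flag (v \<in> set S))) (20 * M)"
    using yields_mem[of v S] sm2 by (auto elim!: yields_le simp: M_def)
  define res where "res = sweep m v B up dn (e # es) acc"
  define Tn where "Tn = 10 + real (length (e # es)) * (400 * (real N + 1)\<^sup>2) + real (deg v (e # es)) * W"
  have "yields f_sweep [edges_enc dn, edges_enc (e # es), VReal (real v), VReal lam, VReal B, VReal (direction up), VReal acc]
    (VReal res) Tn"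
  proof (cases "v \<in> set S")
    case False
    have D': "deg v (e # es) = deg v es" using False by (simp add: e)
    have sw: "sweep m v B up (e1 # dn) es acc = res"
      using False by (simp add: e e1_def res_def)
    have Tn: "T + 70 * M + 20 * M + 40 \<le> Tn"
      using MM unfolding Tn_def T_def D' M_def[symmetric] by (simp add: algebra_simps)
    show ?thesis unfolding yields_def e
      apply (subst f_sweep_def, simp add: wp_simps)
      apply (rule wp_yields[OF pe], (simp add: wp_simps)?)
      apply (rule wp_yields[OF me], (simp add: wp_simps False)?)
      apply (rule wp_yields[OF IH[of acc]])
      using Tn sw by simp
  next
    case True
    define S' where "S' = removeAll v S"
    define A where "A = rev dn @ pin v False es"
    define B' where "B' = B / length S"
    have len: "real (length S) = real (length S') + 1"
      using length_removeAll_distinct[OF dS True] by (simp add: S'_def)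
    have B': "0 < B'" "B' < X"
    proof -
      have "B' \<le> B / 1" unfolding B'_def len using B by (intro divide_left_mono) auto
      then show "0 < B'" "B' < X" using B by (auto simp: B'_def len)
    qed
    have A: "edges_in V A" using Cons.prems edges_in_pin[OF in2, of v False] by (simp add: A_def)
    have S': "set S' \<subseteq> V" "distinct S'" using Cons.prems dS by (auto simp: S'_def e distinct_removeAll)
    have e1: "e1 = (1, g, S')" using True by (simp add: e1_def pin_edge_def S'_def)
    \<comment> \<open>A block makes fewer than \<open>length S\<close> calls with budget
      \<open>B / length S\<close> each. The sizes cancel in the term with \<open>L\<close>, so a
      large hyperedge costs no more there than a small one.\<close>
    have bt: "(real (length S') + 1) * (K + L * B' + 150 * (real N + 1)\<^sup>2) \<le> W / 2"
    proof -
      have "(real (length S') + 1) * (K + L * B' + 150 * (real N + 1)\<^sup>2)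
        = real (length S) * (K + 150 * (real N + 1)\<^sup>2) + L * (real (length S) * B')"
        by (simp add: len algebra_simps)
      also have "real (length S) * B' = B" unfolding B'_def using True by auto
      also have "real (length S) * (K + 150 * (real N + 1)\<^sup>2) \<le> real N * (K + 150 * (real N + 1)\<^sup>2)"
        using sm2 KL by (intro mult_right_mono) auto
      finally show ?thesis by (simp add: W_def)
    qed
    have bl: "yields f_block [edges_enc A, vertices_val S', VReal (flag t), VReal lam, VReal B', VReal (direction up')]
      (VReal (block m t B' up' A S')) (W / 2)" for t up'
      by (rule yields_le[OF yields_block[OF run KL Cons.prems(1) S' A good(1)[folded A_def] _ B'] bt])
        (use sm2 in \<open>simp add: A_def\<close>)
    have pn: "yields f_pin [VReal (real v), VReal 0, edges_enc es] (edges_enc (pin v False es)) (90 * M\<^sup>2)"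
      using yields_pin_small[OF sm2(2), of v False] by (simp add: M_def)
    have ra: "yields f_revapp [edges_enc dn, edges_enc (pin v False es)] (edges_enc A) (20 * M)"
      using yields_revapp[of dn "pin v False es"] sm2 unfolding A_def
      by (auto elim!: yields_le simp: M_def)
    have ln: "yields f_len [vertices_val S] (VReal (real (length S))) (20 * M)"
      using yields_len[of S] sm2 by (auto elim!: yields_le simp: M_def)
    have D': "deg v (e # es) = Suc (deg v es)" using True by (simp add: e)
    define P where "P = block m True B' (\<not> up) A S'"
    define Q where "Q = block m False B' (\<not> up) A S'"
    have sw: "sweep m v B up (e1 # dn) es (acc * ((1 - (1 - g) * P) / (1 - (1 - b) * Q))) = res"
      using True by (simp add: e e1_def factor_def A_def B'_def S'_def P_def Q_def res_def)
    have "0 \<le> Q" "Q \<le> 1"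
      unfolding Q_def using block_bounds(2,3)[OF Cons.prems(1) S' A good(1)[folded A_def] B'] by auto
    then have "1 / 3 \<le> 1 - (1 - b) * Q"
      using ok s by (intro pin_factor_bounds(1)[where s = s]) (auto simp: edge_ok_def)
    then have Q: "1 - (1 - b) * Q \<noteq> 0" by auto
    have lS: "length S \<noteq> 0" using True by auto
    have Tn: "T + 70 * M + 20 * M + 90 * M\<^sup>2 + 20 * M + 20 * M + W / 2 + W / 2 + 90 \<le> Tn"
      using MM unfolding Tn_def T_def D' M_def[symmetric] by (simp add: algebra_simps)
    have bP: "yields f_block [edges_enc A, vertices_val S', VReal 1, VReal lam, VReal (B / real (length S)), VReal (direction (\<not> up))]
      (VReal P) (W / 2)"
      using bl[of True "\<not> up"] by (simp add: P_def B'_def)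
    have bQ: "yields f_block [edges_enc A, vertices_val S', VReal 0, VReal lam, VReal (B / real (length S)), VReal (direction (\<not> up))]
      (VReal Q) (W / 2)"
      using bl[of False "\<not> up"] by (simp add: Q_def B'_def)
    have Sne: "S \<noteq> []" using True by auto
    show ?thesis unfolding yields_def e
      apply (subst f_sweep_def, simp add: wp_simps)
      apply (rule wp_yields[OF pe], (simp add: wp_simps e1)?)
      apply (rule wp_yields[OF me], (simp add: wp_simps True)?)
      apply (rule wp_yields[OF pn], (simp add: wp_simps)?)
      apply (rule wp_yields[OF ra], (simp add: wp_simps)?)
      apply (rule wp_yields[OF ln], (simp add: wp_simps Sne)?)
      apply (rule wp_yields[OF bP], (simp add: wp_simps)?)
      apply (rule wp_yields[OF bQ], (simp add: wp_simps Q[simplified])?)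
      apply (rule wp_yields'[OF IH])
       apply (simp add: e1)
      using Tn sw by simp
  qed
  then show ?case unfolding res_def Tn_def W_def .
qed

end

lemma deg_le_length: "deg v E \<le> length E"
  by (simp add: deg_def)

text \<open>With \<open>d\<close> hyperedges at the vertex and two blocks for each, the children
  receive at most \<open>2 * d * B / (4 * 3 ^ d) \<le> B / 2\<close>. So half of the term linear in
  \<open>B\<close> pays for them. The other half pays for the constant terms of the children, at
  most \<open>1600 * M ^ 6\<close>, because \<open>B \<ge> 1\<close> at an inner call; this is the
  origin of 3200.\<close>

lemma marg_runs:
  fixes N :: nat
  defines "M \<equiv> real N + 1"
  assumes lam: "lam > 0" and s: "0 \<le> s" "s \<le> 2 / 3" and C: "0 \<le> C"
    and acc: "\<And>n. accurate lam s D C c (4 ^ n) (marg lam n)"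
  shows "marg_runs lam s D (4 ^ n) N (marg lam n) (800 * M ^ 4) (3200 * M ^ 6)"
proof (induction n)
  have M: "1 \<le> M" "real N \<le> M" by (simp_all add: M_def)
  have MM: "1 \<le> M ^ 2" "M ^ 2 \<le> M ^ 4" "M ^ 3 \<le> M ^ 4" "1 \<le> M ^ 4" "0 \<le> M ^ 6"
    using M(1) by (auto intro!: one_le_power power_increasing)
  have pw: "yields f_pow3 [edges_enc A, VReal (real u)] (VReal (3 ^ deg u A)) (40 * M ^ 2)"
    if "small N A" for A u using yields_pow3_small[OF that] by (simp add: M_def)
  have leaf: "yields f_marg [edges_enc A, VReal (real u), VReal lam, VReal B, VReal (direction up)]
       (VReal (if up then lam * 3 ^ deg u A else lam / 3 ^ deg u A)) (800 * M ^ 4 + 3200 * M ^ 6 * B)"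
    if A: "small N A" and B: "0 < B" "B < 1" for A u B up
  proof -
    have T: "40 * M ^ 2 + 40 \<le> 800 * M ^ 4 + 3200 * M ^ 6 * B"
      using MM mult_nonneg_nonneg[of "3200 * M ^ 6" B] B by linarith
    define w where "w = (if up then lam * 3 ^ deg u A else lam / 3 ^ deg u A)"
    show ?thesis unfolding yields_def w_def[symmetric]
      apply (subst f_marg_def, simp add: wp_simps)
      apply (rule wp_yields[OF pw[OF A]])
      using T B by (auto simp: wp_simps w_def)
  qed
  {
    case 0
    then show ?case using leaf by (simp add: marg_runs_def)
  next
    case (Suc n)
    define \<eta> where "\<eta> = max (lam * 3 ^ D / (1 + lam * 3 ^ D)) (1 / (1 + lam / 3 ^ D))"
    have "lam * 3 ^ D > 0" "lam / 3 ^ D > 0" using lam by auto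
    then have "lam * 3 ^ D / (1 + lam * 3 ^ D) \<le> \<eta>" "1 / (1 + lam / 3 ^ D) \<le> \<eta>" "\<eta> < 1"
      by (auto simp: \<eta>_def)
    then interpret approximation lam s D C c "4 ^ n" "marg lam n" \<eta>
      using lam s C acc by unfold_locales
    show ?case unfolding marg_runs_def
    proof (intro allI impI)
      fix V :: "nat set" and A u and B :: real and up
      assume V: "finite V" "u \<in> V" "edges_in V A" "good s D A" "small N A" "0 < B" "B < 4 ^ Suc n"
      show "yields f_marg [edges_enc A, VReal (real u), VReal lam, VReal B, VReal (direction up)]
         (VReal (marg lam (Suc n) A u B up)) (800 * M ^ 4 + 3200 * M ^ 6 * B)"
      proof (cases "B < 1")
        case True
        then show ?thesis using leaf[OF V(5,6)] by simp
      next
        case False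
        define d where "d = deg u A"
        define B' where "B' = B / (4 * 3 ^ d)"
        have "B' \<le> B / (4 * 1)" unfolding B'_def using V by (intro divide_left_mono mult_left_mono) auto
        then have B': "0 < B'" "B' < 4 ^ n" using V by (auto simp: B'_def)
        have E: "edges_in (insert u (V - {u})) A" "good s D (rev [] @ A)" "small N (rev [] @ A)"
          "edges_in (V - {u}) []" "u \<notin> V - {u}"
          using V by (simp_all add: insert_absorb edges_in_def)
        define res where "res = sweep (marg lam n) u B' up [] A lam"
        define T where "T = 10 + real (length A) * (400 * M ^ 2) +
            real d * (2 * (real N * (800 * M ^ 4 + 150 * M ^ 2) + 3200 * M ^ 6 * B'))"
        have sw: "yields f_sweep [VNil, edges_enc A, VReal (real u), VReal lam,
            VReal (B / (4 * 3 ^ deg u A)), VReal (direction up), VReal lam] (VReal res) T"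
          using yields_sweep[OF Suc _ _ finite_Diff[OF V(1)] E(5,4,1,2,3) B', of up lam] MM
          by (simp add: res_def T_def M_def d_def B'_def)
        have TM: "T \<le> 10 + 400 * M ^ 4 + 2 * (800 * M ^ 6 + 150 * M ^ 4) + 1600 * M ^ 6 * B"
        proof -
          have lA: "real (length A) \<le> M" "real d \<le> M"
            using V(5) deg_le_length[of u A] M(2) by (auto simp: small_def d_def)
          then have 1: "real (length A) * (400 * M ^ 2) \<le> M * (400 * M ^ 2)"
            by (intro mult_right_mono) auto
          have 2: "real d * (2 * (real N * (800 * M ^ 4 + 150 * M ^ 2))) \<le> M * (2 * (M * (800 * M ^ 4 + 150 * M ^ 2)))"
            using lA M by (intro mult_mono mult_left_mono) auto
          have "real d \<le> 3 ^ d"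
            using of_nat_less_two_power[of d, where ?'a = real] power_mono[of 2 "3::real" d] by linarith
          then have "real d * B' \<le> 3 ^ d * B'" using B' by (intro mult_right_mono) auto
          also have "3 ^ d * B' = B / 4" by (simp add: B'_def)
          finally have 3: "2 * 3200 * M ^ 6 * (real d * B') \<le> 2 * 3200 * M ^ 6 * (B / 4)"
            using MM by (intro mult_left_mono) auto
          have e: "M * (400 * M ^ 2) = 400 * M ^ 3"
             "M * (2 * (M * (800 * M ^ 4 + 150 * M ^ 2))) = 2 * (800 * M ^ 6 + 150 * M ^ 4)"
            by (simp_all add: algebra_simps power_numeral_reduce)
          have "T = 10 + real (length A) * (400 * M ^ 2) +
            real d * (2 * (real N * (800 * M ^ 4 + 150 * M ^ 2))) + 2 * 3200 * M ^ 6 * (real d * B')"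
            unfolding T_def by (simp add: algebra_simps)
          then show ?thesis using 1 2 3 MM unfolding e by linarith
        qed
        have MB: "M ^ 6 \<le> M ^ 6 * B" using False MM(5) by (simp add: mult_le_cancel_left1)
        have T: "40 * M ^ 2 + T + 40 \<le> 800 * M ^ 4 + 3200 * M ^ 6 * B"
        proof -
          have aux: "40 * p + T + 40 \<le> 800 * q + 3200 * z"
            if "T \<le> 10 + 400 * q + 2 * (800 * x + 150 * q) + 1600 * z" "x \<le> z" "p \<le> q" "1 \<le> q"
            for p q x z :: real
          proof -
            have "T \<le> 10 + 700 * q + 3200 * z" using that by simp
            then show ?thesis using that by simp
          qed
          show ?thesis unfolding mult.assoc by (rule aux) (use TM MB MM in \<open>auto simp: mult.assoc\<close>)
        qed
        have m: "marg lam (Suc n) A u B up = res" using False by (simp add: res_def B'_def d_def)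
        show ?thesis unfolding m yields_def
          apply (subst f_marg_def, simp add: wp_simps split del: if_split)
          apply (rule wp_yields[OF pw[OF V(5)]])
          apply (simp add: wp_simps False split del: if_split)
          apply (rule wp_yields[OF sw])
          using T by simp
      qed
    qed
  }
qed

lemma yields_zval:
  fixes N :: nat
  defines "M \<equiv> real N + 1"
  assumes run: "marg_runs lam s D X N (marg lam n) K L" and KL: "0 \<le> K" "0 \<le> L"
    and s: "0 \<le> s" and B: "0 < B" "B < X"
    and "distinct vs" "edges_in (set vs) E" "good s D E" "small N E"
  shows "yields f_zval [vertices_val vs, edges_enc E, VReal lam, VReal B, VReal (direction up)]
    (VReal (zval lam n B up E vs)) ((real (length vs) + 1) * (K + L * B + 200 * M\<^sup>2))"
  using assms(8-)
proof (induction vs arbitrary: E)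
  have M: "1 \<le> M" "1 \<le> M\<^sup>2" "M \<le> M\<^sup>2"
    using one_le_power[of M 2] by (auto simp: M_def power2_eq_square)
  have KLB: "0 \<le> K + L * B" using KL B by simp
  {
    case Nil
    have "yields f_prodb [edges_enc E] (VReal (prod_list (map fst E))) (20 * M)"
      using yields_prodb[of E] Nil by (auto elim!: yields_le simp: M_def small_def)
    note pb = this
    have T: "20 * M + 10 \<le> K + L * B + 200 * M\<^sup>2" using M KLB by linarith
    show ?case unfolding yields_def
      apply (subst f_zval_def, simp add: wp_simps)
      apply (rule wp_yields[OF pb])
      using T by simp
  next
    case (Cons v vs)
    define r where "r = marg lam n E v B up"
    define z where "z = zval lam n B up (pin v False E) vs"
    have mr: "yields f_marg [edges_enc E, VReal (real v), VReal lam, VReal B, VReal (direction up)] (VReal r) (K + L * B)"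
      using run Cons.prems B unfolding marg_runs_def r_def by (metis List.finite_set list.set_intros(1))
    have pn: "yields f_pin [VReal (real v), VReal 0, edges_enc E] (edges_enc (pin v False E)) (90 * M\<^sup>2)"
      using yields_pin_small[OF Cons.prems(4), of v False] by (simp add: M_def)
    define T where "T = (real (length vs) + 1) * (K + L * B + 200 * M\<^sup>2)"
    have "edges_in (set vs) (pin v False E)"
      using edges_in_pin[OF Cons.prems(2), of v False] Cons.prems(1) by simp
    then have IH: "yields f_zval [vertices_val vs, edges_enc (pin v False E), VReal lam, VReal B, VReal (direction up)] (VReal z) T"
      unfolding z_def T_def using Cons.prems s by (intro Cons.IH) (auto intro: good_pin small_pin)
    define Tn where "Tn = (real (length (v # vs)) + 1) * (K + L * B + 200 * M\<^sup>2)"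
    have "Tn = T + (K + L * B + 200 * M\<^sup>2)" by (simp add: Tn_def T_def algebra_simps)
    then have Tn: "T + (K + L * B) + 90 * M\<^sup>2 + 60 \<le> Tn" using M by linarith
    have zv: "zval lam n B up E (v # vs) = (1 + r) * z" by (simp add: r_def z_def)
    show ?case unfolding zv Tn_def[symmetric] yields_def
      apply (subst f_zval_def, simp add: wp_simps)
      apply (rule wp_yields[OF mr], (simp add: wp_simps)?)
      apply (rule wp_yields[OF pn], (simp add: wp_simps)?)
      apply (rule wp_yields[OF IH])
      using Tn by simp
  }
qed

text \<open>The budgets from \<open>2 ^ k\<close> to \<open>2 ^ J\<close> add up to
  \<open>2 ^ (J + 1) - 2 ^ k\<close>, so the rounds together cost about twice the last one. The
  search may stop at an earlier \<open>j\<close>, whose bounds pass the same test.\<close>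

lemma yields_search:
  fixes lo hi :: "nat \<Rightarrow> real"
  assumes lo: "\<And>k. yields f_zval [W, E, lam, VReal (2 ^ k), VReal (- 1)] (VReal (lo k)) (F * 2 ^ k)"
    and hi: "\<And>k. yields f_zval [W, E, lam, VReal (2 ^ k), VReal 1] (VReal (hi k)) (F * 2 ^ k)"
    and J: "hi J < lo J * (1 + eps)" and "k \<le> J"
  shows "\<exists>j. hi j < lo j * (1 + eps) \<and>
    yields f_search [W, E, lam, VReal eps, VReal (2 ^ k)] (VReal (lo j)) ((2 * F + 100) * (2 ^ (J + 1) - 2 ^ k))"
  using \<open>k \<le> J\<close>
proof (induction "J - k" arbitrary: k)
  have stop: "yields f_search [W, E, lam, VReal eps, VReal (2 ^ k)] (VReal (lo k)) (2 * F * 2 ^ k + 100)"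
    if "hi k < lo k * (1 + eps)" for k unfolding yields_def
    apply (subst f_search_def, simp add: wp_simps)
    apply (rule wp_yields[OF lo], (simp add: wp_simps)?)
    apply (rule wp_yields[OF hi])
    using that by (simp add: wp_simps)
  have p: "(1::real) \<le> 2 ^ k" for k by simp
  {
    case 0
    then have "k = J" by simp
    have "2 * F * 2 ^ J + 100 \<le> (2 * F + 100) * (2 ^ (J + 1) - 2 ^ J)"
      using p[of J] by (simp add: algebra_simps)
    then show ?case using stop[OF J] J yields_le unfolding \<open>k = J\<close> by blast
  next
    case (Suc i)
    show ?case
    proof (cases "hi k < lo k * (1 + eps)")
      case True
      have "F \<ge> 0"
      proof -
        have "\<exists>t. real t \<le> F * 2 ^ k" for k
          using lo[of k] unfolding yields_def wp_def by auto
        then obtain t where "real t \<le> F * 2 ^ 0" by blast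
        then show ?thesis by simp
      qed
      have "(2::real) ^ k \<le> 2 ^ J" using Suc.prems by (intro power_increasing) auto
      then have "(2 * F + 100) * (2 ^ k) \<le> (2 * F + 100) * (2 ^ (J + 1) - 2 ^ k)"
        using \<open>F \<ge> 0\<close> by (intro mult_left_mono) auto
      moreover have "2 * F * 2 ^ k + 100 \<le> (2 * F + 100) * 2 ^ k" using p[of k] by (simp add: algebra_simps)
      ultimately show ?thesis using stop[OF True] True yields_le order_trans by blast
    next
      case False
      have k: "i = J - Suc k" "Suc k \<le> J" using Suc.hyps(2) by auto
      obtain j where j: "hi j < lo j * (1 + eps)" and
        y: "yields f_search [W, E, lam, VReal eps, VReal (2 ^ Suc k)] (VReal (lo j)) ((2 * F + 100) * (2 ^ (J + 1) - 2 ^ Suc k))"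
        using Suc.hyps(1)[OF k] by blast
      define T where "T = (2 * F + 100) * (2 ^ (J + 1) - 2 ^ Suc k)"
      define Tn where "Tn = (2 * F + 100) * (2 ^ (J + 1) - 2 ^ k)"
      have "Tn = T + (2 * F + 100) * 2 ^ k" by (simp add: T_def Tn_def algebra_simps)
      then have Tn: "T + 2 * (F * 2 ^ k) + 100 \<le> Tn" using p[of k] by (simp add: algebra_simps)
      have "yields f_search [W, E, lam, VReal eps, VReal (2 ^ k)] (VReal (lo j)) Tn" unfolding yields_def
        apply (subst f_search_def, simp add: wp_simps)
        apply (rule wp_yields[OF lo], (simp add: wp_simps)?)
        apply (rule wp_yields[OF hi])
        apply (simp add: wp_simps False)
        apply (rule wp_yields[OF y[folded T_def, simplified]])
        using Tn by simp
      then show ?thesis using j unfolding Tn_def by blast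
    qed
  }
qed

section \<open>The approximation scheme\<close>

lemma power_two_between:
  fixes x :: real
  assumes "1 \<le> x"
  shows "\<exists>J::nat. x \<le> 2 ^ J \<and> 2 ^ J \<le> 2 * x"
proof -
  have ex: "\<exists>n::nat. x \<le> 2 ^ n" using real_arch_pow[of 2 x] by (auto intro: less_imp_le)
  define J where "J = (LEAST n::nat. x \<le> 2 ^ n)"
  have "x \<le> 2 ^ J" unfolding J_def using ex by (rule LeastI_ex)
  moreover have "2 ^ J \<le> 2 * x"
  proof (cases J)
    case 0
    then show ?thesis using assms by simp
  next
    case (Suc i)
    then have "\<not> x \<le> 2 ^ i" using not_less_Least[of i "\<lambda>n. x \<le> 2 ^ n"] by (simp add: J_def)
    then show ?thesis using Suc by simp
  qed
  ultimately show ?thesis by blast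
qed

lemma empty_weight_pos:
  assumes "good s D E" "s \<le> 2 / 3"
  shows "0 < empty_weight E"
proof -
  have "\<forall>e\<in>set E. fst (snd e) > 0" using assms by (force simp: good_def)
  then show ?thesis unfolding empty_weight_def by (induction E) auto
qed

text \<open>Solves \<open>n * C * X powr (- c) < \<epsilon> / 2\<close> for the budget. The natural
  number \<open>m\<close> stands for \<open>1 / c\<close> rounded up, so a polynomial budget
  suffices; the summand 1 in the base keeps it at least 1 and makes the inequality strict.\<close>

lemma decay_target:
  fixes C c \<epsilon> :: real and m :: nat
  assumes "0 < C" "0 < c" "0 < \<epsilon>" "1 \<le> real m * c" "(2 * n * C / \<epsilon> + 1) ^ m \<le> X" "0 \<le> n"
  shows "n * (C * X powr (- c)) < \<epsilon> / 2"
proof -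
  define q where "q = 2 * n * C / \<epsilon> + 1"
  have q: "1 \<le> q" using assms by (simp add: q_def)
  have "q powr 1 \<le> q powr (real m * c)" using q assms by (intro powr_mono) auto
  also have "\<dots> = (q ^ m) powr c" using q by (simp add: powr_powr flip: powr_realpow)
  also have "\<dots> \<le> X powr c" using assms q by (intro powr_mono2) (auto simp: q_def)
  finally have qX: "q \<le> X powr c" using q by simp
  have "n * (C * X powr (- c)) = n * C / X powr c" by (simp add: powr_minus_divide)
  also have "\<dots> \<le> n * C / q" using qX q assms by (intro divide_left_mono mult_pos_pos) auto
  also have "\<dots> < \<epsilon> / 2"
  proof -
    have "q * \<epsilon> = 2 * n * C + \<epsilon>" using assms by (simp add: q_def field_simps)
    then have "n * C < \<epsilon> / 2 * q" using assms by (simp add: algebra_simps)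
    then show ?thesis using q by (simp add: divide_simps)
  qed
  finally show ?thesis .
qed

text \<open>Turns a logarithmic gap of \<open>\<epsilon> / 2\<close> into the stopping test with
  \<open>1 + \<epsilon>\<close>, which needs field operations only.\<close>

lemma exp_half_le: "0 \<le> \<epsilon> \<Longrightarrow> \<epsilon> \<le> 1 \<Longrightarrow> exp (\<epsilon> / 2) \<le> 1 + \<epsilon>" for \<epsilon> :: real
proof -
  assume e: "0 \<le> \<epsilon>" "\<epsilon> \<le> 1"
  have "exp (\<epsilon> / 2) \<le> 1 + \<epsilon> / 2 + (\<epsilon> / 2)\<^sup>2" using e by (intro exp_bound) auto
  also have "(\<epsilon> / 2)\<^sup>2 \<le> \<epsilon> / 2" unfolding power2_eq_square using e by (intro mult_left_le) auto
  finally show ?thesis by simp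
qed

lemma scheme_on_instance:
  fixes G :: "nat spin_instance" and m :: nat
  assumes lam: "lam > 0" and s: "0 \<le> s" "s \<le> 2 / 3" and C: "0 < C" and c: "0 < c"
    and acc: "\<And>n. accurate lam s D C c (4 ^ n) (marg lam n)"
    and l: "listing G vs es" and v: "valid_instance G" and D: "max_degree G = D"
    and wts: "\<forall>e\<in>hedges G. 1 - s \<le> beta_wt G e \<and> beta_wt G e \<le> 1 \<and> 1 - s \<le> gamma_wt G e \<and> gamma_wt G e \<le> 1"
    and eps: "0 < \<epsilon>" "\<epsilon> < 1" and m: "1 \<le> real m * c"
  defines "n \<equiv> length vs" and "M \<equiv> real (length vs * D + 1 + length vs) + 1"
  shows "\<exists>z. exp (- \<epsilon>) \<le> partition_fun lam G / z \<and> partition_fun lam G / z \<le> exp \<epsilon> \<and>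
    yields f_main [instance_val G vs es, VReal lam, VReal \<epsilon>] (VReal z)
      (120 + (2 * ((real n + 1) * (800 * M ^ 4 + 3200 * M ^ 6 + 200 * M\<^sup>2)) + 100) *
        (4 * (2 * real n * C / \<epsilon> + 1) ^ m))"
proof -
  define E where "E = map (edge_of G) es"
  define N where "N = length vs * D + 1 + length vs"
  have M: "M = real N + 1" by (simp add: M_def N_def)
  note gl = good_listing[OF l v D s(1) wts, folded E_def]
  have sm: "small N E"
    using length_listing[OF l v gl[unfolded E_def]] by (auto simp: small_def N_def E_def edge_of_def intro: trans_le_add2 le_SucI)
  have dvs: "distinct vs" using l by (simp add: listing_def)
  \<comment> \<open>The program has no depth argument; depth \<open>Suc k\<close> covers the budget
    \<open>2 ^ k\<close>, which is below \<open>4 ^ Suc k\<close>.\<close>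
  define val where "val up k = zval lam (Suc k) (2 ^ k) up E vs" for up k
  define F where "F = (real n + 1) * (800 * M ^ 4 + 3200 * M ^ 6 + 200 * M\<^sup>2)"
  have B: "(0::real) < 2 ^ k" "(2::real) ^ k < 4 ^ Suc k" for k
  proof -
    have "(2::real) ^ k \<le> 4 ^ k" by (intro power_mono) auto
    also have "\<dots> < 4 ^ Suc k" by simp
    finally show "(2::real) ^ k < 4 ^ Suc k" .
  qed simp
  have edge_wt: "0 < empty_weight E" using empty_weight_pos[OF gl(1) s(2)] .
  have val: "0 < val up k" "val False k \<le> partition_fun lam G" "partition_fun lam G \<le> val True k"
     "ln (val True k) - ln (val False k) \<le> real n * (C * (2 ^ k) powr (- c))" for up k
  proof -
    note zp = zval_props[OF lam s acc B dvs gl(2,1), folded val_def n_def,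
        folded partition_fun_eq_Z[OF l v, folded E_def]]
    show "0 < val up k" using zp by blast
    show "ln (val True k) - ln (val False k) \<le> real n * (C * (2 ^ k) powr (- c))" using zp by blast
    have "bounds True (val True k * empty_weight E) (partition_fun lam G * empty_weight E)"
      "bounds False (val False k * empty_weight E) (partition_fun lam G * empty_weight E)"
      using zp by blast+
    then show "val False k \<le> partition_fun lam G" "partition_fun lam G \<le> val True k"
      using edge_wt by (simp_all add: bounds_def)
  qed
  have yz: "yields f_zval [vertices_val vs, edges_enc E, VReal lam, VReal (2 ^ k), VReal (direction up)]
     (VReal (val up k)) (F * 2 ^ k)" for k up
  proof (unfold val_def, rule yields_le[OF yields_zval[OF marg_runs[OF lam s _ acc] _ _ s(1) B dvs gl(2,1) sm]])
    have "800 * M ^ 4 + 3200 * M ^ 6 * 2 ^ k + 200 * M\<^sup>2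
        \<le> 800 * M ^ 4 * 2 ^ k + 3200 * M ^ 6 * 2 ^ k + 200 * M\<^sup>2 * 2 ^ k"
      by (intro add_mono order_refl) (simp_all add: mult_le_cancel_left1 M_def)
    also have "\<dots> = (800 * M ^ 4 + 3200 * M ^ 6 + 200 * M\<^sup>2) * 2 ^ k" by (simp add: algebra_simps)
    finally show "(real (length vs) + 1) * (800 * (real N + 1) ^ 4 + 3200 * (real N + 1) ^ 6 * 2 ^ k + 200 * (real N + 1)\<^sup>2)
      \<le> F * 2 ^ k"
      unfolding F_def n_def M[symmetric] mult.assoc by (intro mult_left_mono) (auto simp: mult.assoc)
  qed (use C in auto)
  have q: "1 \<le> (2 * real n * C / \<epsilon> + 1) ^ m" using C eps by (intro one_le_power) simp
  obtain J :: nat where J: "(2 * real n * C / \<epsilon> + 1) ^ m \<le> 2 ^ J" "2 ^ J \<le> 2 * (2 * real n * C / \<epsilon> + 1) ^ m"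
    using power_two_between[OF q] by blast
  have "ln (val True J) - ln (val False J) < \<epsilon> / 2"
    using val(4)[of J] decay_target[OF C c eps(1) m J(1)] by linarith
  then have "ln (val True J) < ln (val False J * exp (\<epsilon> / 2))"
    using val(1)[of False J] by (simp add: ln_mult)
  then have "val True J < val False J * exp (\<epsilon> / 2)"
    using val(1) by (subst (asm) ln_less_cancel_iff) auto
  also have "\<dots> \<le> val False J * (1 + \<epsilon>)"
    using val(1)[of False J] exp_half_le[of \<epsilon>] eps by (intro mult_left_mono) auto
  finally have stop: "val True J < val False J * (1 + \<epsilon>)" .
  obtain j where j: "val True j < val False j * (1 + \<epsilon>)"
    and y: "yields f_search [vertices_val vs, edges_enc E, VReal lam, VReal \<epsilon>, VReal (2 ^ 0)] (VReal (val False j))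
      ((2 * F + 100) * (2 ^ (J + 1) - 2 ^ 0))"
    using yields_search[OF yz[where up = False, simplified] yz[where up = True, simplified] stop, of 0] by auto
  have "0 \<le> F" unfolding F_def M_def by (intro mult_nonneg_nonneg add_nonneg_nonneg) auto
  then have "(2 * F + 100) * (2 ^ (J + 1) - 2 ^ 0) \<le> (2 * F + 100) * (4 * (2 * real n * C / \<epsilon> + 1) ^ m)"
    using J(2) by (intro mult_left_mono) auto
  note y' = yields_le[OF y this]
  have enc: "instance_val G vs es = VCons (vertices_val vs) (edges_enc E)"
    by (simp add: instance_val_def edges_enc_def E_def o_def edge_enc_def edge_of_def edge_val_def[abs_def])
  have "yields f_main [instance_val G vs es, VReal lam, VReal \<epsilon>] (VReal (val False j))
      (120 + (2 * F + 100) * (4 * (2 * real n * C / \<epsilon> + 1) ^ m))"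
    unfolding yields_def enc
    apply (subst f_main_def, simp add: wp_simps)
    apply (rule wp_yields[OF y'[simplified]])
    by simp
  moreover have "exp (- \<epsilon>) \<le> 1" "1 + \<epsilon> \<le> exp \<epsilon>" using eps by auto
  \<comment> \<open>The lower bound is returned, so the quotient lies between 1 and
    \<open>1 + \<epsilon>\<close>, inside the required interval.\<close>
  moreover have "1 \<le> partition_fun lam G / val False j" "partition_fun lam G / val False j \<le> 1 + \<epsilon>"
    using val(1)[of False j] val(2,3)[of j] j by (simp_all add: field_simps)
  ultimately show ?thesis unfolding F_def by (intro exI[of _ "val False j"]) linarith
qed

theorem theorem3:
  fixes lam :: real
  assumes "lam > 0"
  shows "\<exists>P. \<forall>\<Delta>::nat. is_FPTAS P lam
    {G. valid_instance G \<and> max_degree G = \<Delta> \<and>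
        (\<forall>e\<in>hedges G.
           1 - 2 / (2 * exp (- 1 / 2) * real \<Delta> + 3) \<le> beta_wt G e \<and> beta_wt G e \<le> 1 \<and>
           1 - 2 / (2 * exp (- 1 / 2) * real \<Delta> + 3) \<le> gamma_wt G e \<and> gamma_wt G e \<le> 1)}"
proof (intro exI allI)
  fix \<Delta> :: nat
  define s where "s = 2 / (2 * exp (- 1 / 2) * real \<Delta> + 3)"
  have s: "0 \<le> s" "s \<le> 2 / 3"
    using frac_le[of 2 2 3 "2 * exp (- 1 / 2) * real \<Delta> + 3"] by (auto simp: s_def)
  obtain C c where C: "C > 0" and c: "c > 0" and acc: "\<And>n. accurate lam s \<Delta> C c (4 ^ n) (marg lam n)"
    using marg_accurate_exists[OF assms s_def] by blast
  define m where "m = nat \<lceil>1 / c\<rceil>"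
  have "1 / c \<le> real m" unfolding m_def by (rule real_nat_ceiling_ge)
  then have m: "1 \<le> real m * c" using c by (simp add: field_simps)
  \<comment> \<open>With \<open>y = n + 1 / \<epsilon>\<close>, these constants give
    \<open>M \<le> a * y\<close> and \<open>2 * n * C / \<epsilon> + 1 \<le> b * y\<^sup>2\<close>;
    4200 is the sum of the coefficients 800, 3200 and 200.\<close>
  define a where "a = real \<Delta> + 3"
  define b where "b = 2 * C + 1"
  define const where "const = 120 + (2 * (4200 * a ^ 6) + 100) * (4 * b ^ m)"
  show "is_FPTAS prog lam
    {G. valid_instance G \<and> max_degree G = \<Delta> \<and>
        (\<forall>e\<in>hedges G.
           1 - 2 / (2 * exp (- 1 / 2) * real \<Delta> + 3) \<le> beta_wt G e \<and> beta_wt G e \<le> 1 \<and>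
           1 - 2 / (2 * exp (- 1 / 2) * real \<Delta> + 3) \<le> gamma_wt G e \<and> gamma_wt G e \<le> 1)}"
    unfolding is_FPTAS_def s_def[symmetric]
  \<comment> \<open>Of the exponent, 6 comes from \<open>M ^ 6\<close>, 1 from the number of
    marginals evaluated for one bound, and \<open>2 * m\<close> from the budget, as
    \<open>n / \<epsilon>\<close> is at most the square of
    \<open>n + 1 / \<epsilon>\<close>.\<close>
  proof (rule exI[of _ const], rule exI[of _ "7 + 2 * m"], intro ballI allI impI, elim CollectE conjE)
    fix G vs es and \<epsilon> :: real
    assume l: "listing G vs es" and eps: "0 < \<epsilon>" "\<epsilon> < 1" and v: "valid_instance G" and D: "max_degree G = \<Delta>"
      and w: "\<forall>e\<in>hedges G. 1 - s \<le> beta_wt G e \<and> beta_wt G e \<le> 1 \<and> 1 - s \<le> gamma_wt G e \<and> gamma_wt G e \<le> 1"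
    define n where "n = real (length vs)"
    define y where "y = n + 1 / \<epsilon>"
    define M where "M = real (length vs * \<Delta> + 1 + length vs) + 1"
    define T where "T = 120 + (2 * ((n + 1) * (800 * M ^ 4 + 3200 * M ^ 6 + 200 * M\<^sup>2)) + 100) *
        (4 * (2 * n * C / \<epsilon> + 1) ^ m)"
    obtain z where z: "exp (- \<epsilon>) \<le> partition_fun lam G / z" "partition_fun lam G / z \<le> exp \<epsilon>"
      and yl: "yields f_main [instance_val G vs es, VReal lam, VReal \<epsilon>] (VReal z) T"
      using scheme_on_instance[OF assms s C c acc l v D w eps m] unfolding T_def n_def M_def by blast
    obtain t where t: "runs prog [instance_val G vs es, VReal lam, VReal \<epsilon>] f_main (VReal z) t" "real t \<le> T"
      using yl by (auto simp: yields_def wp_def)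
    have card: "real (card (verts G)) = n"
      using l distinct_card[of vs] by (simp add: listing_def n_def)
    have n: "0 \<le> n" by (simp add: n_def)
    have e1: "1 < 1 / \<epsilon>" using eps by simp
    then have y: "n + 1 \<le> y" "1 \<le> y" "1 / \<epsilon> \<le> y" "n \<le> y" using n unfolding y_def by linarith+
    have "M = n * (real \<Delta> + 1) + 2" by (simp add: M_def n_def algebra_simps)
    also have "\<dots> \<le> y * (real \<Delta> + 1) + 2 * y" using y by (intro add_mono mult_right_mono) auto
    finally have Ma: "M \<le> a * y" by (simp add: a_def algebra_simps)
    have M1: "1 \<le> M" by (simp add: M_def)
    have a: "1 \<le> a" and b: "1 \<le> b" using C by (simp_all add: a_def b_def)
    have "M ^ 4 \<le> M ^ 6" "M\<^sup>2 \<le> M ^ 6" using M1 by (auto intro!: power_increasing)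
    then have "800 * M ^ 4 + 3200 * M ^ 6 + 200 * M\<^sup>2 \<le> 4200 * M ^ 6" by linarith
    also have "\<dots> \<le> 4200 * (a * y) ^ 6" using Ma M1 by (intro mult_left_mono power_mono) auto
    finally have "(n + 1) * (800 * M ^ 4 + 3200 * M ^ 6 + 200 * M\<^sup>2) \<le> y * (4200 * (a * y) ^ 6)"
      using y n M1 by (intro mult_mono) auto
    also have "\<dots> = 4200 * a ^ 6 * y ^ 7" by (simp add: power_mult_distrib power_numeral_reduce)
    finally have F: "2 * ((n + 1) * (800 * M ^ 4 + 3200 * M ^ 6 + 200 * M\<^sup>2)) + 100 \<le> (2 * (4200 * a ^ 6) + 100) * y ^ 7"
      using one_le_power[OF y(2), of 7] by (simp add: algebra_simps)
    have "n * (1 / \<epsilon>) \<le> y * y" using y n eps by (intro mult_mono) auto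
    then have "C * (n * (1 / \<epsilon>)) \<le> C * (y * y)" using C by (intro mult_left_mono) auto
    moreover have "1 \<le> y * y" using y mult_mono[of 1 y 1 y] by simp
    moreover have "2 * n * C / \<epsilon> + 1 = 2 * (C * (n * (1 / \<epsilon>))) + 1" by simp
    moreover have "b * y\<^sup>2 = 2 * (C * (y * y)) + y * y" by (simp add: b_def power2_eq_square algebra_simps)
    ultimately have "2 * n * C / \<epsilon> + 1 \<le> b * y\<^sup>2" by linarith
    then have Q: "(2 * n * C / \<epsilon> + 1) ^ m \<le> (b * y\<^sup>2) ^ m"
      using n C eps by (intro power_mono) auto
    have "T \<le> 120 + ((2 * (4200 * a ^ 6) + 100) * y ^ 7) * (4 * (b * y\<^sup>2) ^ m)"
      unfolding T_def using F Q n C eps a y by (intro add_left_mono mult_mono) auto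
    also have "\<dots> = 120 + (2 * (4200 * a ^ 6) + 100) * (4 * b ^ m) * y ^ (7 + 2 * m)"
      by (simp add: power_mult_distrib power_add power_mult)
    also have "\<dots> \<le> const * y ^ (7 + 2 * m)"
      using one_le_power[OF y(2), of "7 + 2 * m"] by (simp add: const_def distrib_right)
    finally have "real t \<le> const * (real (card (verts G)) + 1 / \<epsilon>) ^ (7 + 2 * m)"
      using t(2) by (simp add: card y_def)
    moreover have "computes prog [instance_val G vs es, VReal lam, VReal \<epsilon>] (VReal z) t"
      using t(1) by (simp add: computes_def prog_def)
    ultimately show "\<exists>Zhat t. computes prog [instance_val G vs es, VReal lam, VReal \<epsilon>] (VReal Zhat) t \<and>
        exp (- \<epsilon>) \<le> partition_fun lam G / Zhat \<and> partition_fun lam G / Zhat \<le> exp \<epsilon> \<and>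
        real t \<le> const * (real (card (verts G)) + 1 / \<epsilon>) ^ (7 + 2 * m)"
      using z by blast
  qed
qed

end
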